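(* Let $s \geq 2$ be an integer, $n = 2^s$, and let $L_s$ be the latin square of order $n$ (rows, columns and symbols indexed by $\{0,1,\ldots,n-1\}$) whose cell $(x,y)$ contains $x \oplus y$, where $\oplus$ denotes bitwise exclusive-or of binary representations. Let $k,k' \in \{0,\ldots,n-1\}$ satisfy $|k-k'| < 3$ and $j \leq k < k' < j+4$ for some integer $j \equiv 0 \pmod 4$. Let $\alpha_{k,k'}$ be the permutation of $\{0,\ldots,n-1\}$ that swaps $k$ and $k'$ and fixes every other element, and let $\alpha_{k,k'} L_s = \{(\alpha_{k,k'}(r), c; e) \mid (r,c;e) \in L_s\}$ (the latin square obtained from $L_s$ by interchanging rows $k$ and $k'$). Then $\mathrm{gcs}(\alpha_{k,k'} L_s)$ is 2-critical, has strong completion to $\alpha_{k,k'} L_s$, and completes top down to $\alpha_{k,k'} L_s$.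
   Context: A latin square of order $n$ is an $n\times n$ array with rows, columns and symbols indexed by $N_n=\{0,\ldots,n-1\}$ in which each symbol occurs exactly once in each row and each column; a partial latin square is such an array with some cells empty and each symbol at most once per row and column. Both are identified with sets of triples $(r,c;e)$ meaning symbol $e$ is in cell $(r,c)$. A partial latin square $P$ contained in a latin square $L$ is uniquely completable (to $L$) if $L$ is the only latin square of order $n$ containing $P$. A critical set of $L$ is a uniquely completable $C \subseteq L$ such that no proper subset of $C$ is uniquely completable. An intercalate is a $2\times 2$ subsquare, i.e. a set $\{(r_1,c_1;a),(r_1,c_2;b),(r_2,c_1;b),(r_2,c_2;a)\}\subseteq L$ with $r_1\ne r_2$, $c_1\ne c_2$. A critical set $C$ is 2-critical if for every $x \in C$ there is an intercalate $I \subseteq L$ with $C \cap I = \{x\}$. The greedy critical set $\mathrm{gcs}(L)$ of a latin square $L$ of order $n$ is defined as follows: start with $P = L$ and process the cells in the order $(n-1,n-1),(n-1,n-2),\ldots,(n-1,0),(n-2,n-1),\ldots,(n-2,0),\ldots,(0,n-1),\ldots,(0,0)$ (rows from bottom to top, each row from right to left); at each cell $(x,y)$, with $(x,y;z)\in P$, replace $P$ by $P\setminus\{(x,y;z)\}$ if that set is still uniquely completable (to $L$), otherwise keep $P$. The final $P$ is $\mathrm{gcs}(L)$. For a partial latin square $P$ and an empty cell $(r,c)$ of $P$, the set of alternatives at $(r,c)$ is $N_n \setminus (\mathcal{R}^r_P \cup \mathcal{C}^c_P)$, where $\mathcal{R}^r_P$ and $\mathcal{C}^c_P$ are the sets of symbols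 occurring in row $r$ and in column $c$ of $P$. $P$ has strong completion to $L$ if it is uniquely completable to $L$ and there is a chain $P = P_0 \subset P_1 \subset \cdots \subset P_m = L$, $m = n^2 - |P|$, where each $P_{t+1}$ is obtained from $P_t$ by filling an empty cell whose set of alternatives (with respect to $P_t$) has exactly one element, with that element. $P$ completes top down to $L$ if, for each $i$, once rows $0,\ldots,i-1$ have been filled in as in $L$, the entries of row $i$ have a unique extension (are uniquely determined), so that all rows can be filled successively from top to bottom. *)

theory Defs
  imports "HOL-Combinatorics.Transposition" "HOL-Number_Theory.Cong"
begin

text \<open>An array is a set of triples (row, column, symbol), with all indices in {..<n}.\<close>

type_synonym array = "(nat \<times> nat \<times> nat) set"

definition partial_latin_square :: "nat \<Rightarrow> array \<Rightarrow> bool" where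
  "partial_latin_square n P \<longleftrightarrow>
     P \<subseteq> {..<n} \<times> {..<n} \<times> {..<n} \<and>
     (\<forall>r c e e'. (r, c, e) \<in> P \<and> (r, c, e') \<in> P \<longrightarrow> e = e') \<and>
     (\<forall>r c c' e. (r, c, e) \<in> P \<and> (r, c', e) \<in> P \<longrightarrow> c = c') \<and>
     (\<forall>r r' c e. (r, c, e) \<in> P \<and> (r', c, e) \<in> P \<longrightarrow> r = r')"

definition latin_square :: "nat \<Rightarrow> array \<Rightarrow> bool" where
  "latin_square n L \<longleftrightarrow>
     L \<subseteq> {..<n} \<times> {..<n} \<times> {..<n} \<and>
     (\<forall>r<n. \<forall>c<n. \<exists>!e. (r, c, e) \<in> L) \<and>
     (\<forall>r<n. \<forall>e<n. \<exists>!c. (r, c, e) \<in> L) \<and>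
     (\<forall>c<n. \<forall>e<n. \<exists>!r. (r, c, e) \<in> L)"

definition uniquely_completable :: "nat \<Rightarrow> array \<Rightarrow> array \<Rightarrow> bool" where
  "uniquely_completable n P L \<longleftrightarrow>
     latin_square n L \<and> P \<subseteq> L \<and> (\<forall>L'. latin_square n L' \<and> P \<subseteq> L' \<longrightarrow> L' = L)"

definition critical_set :: "nat \<Rightarrow> array \<Rightarrow> array \<Rightarrow> bool" where
  "critical_set n C L \<longleftrightarrow>
     uniquely_completable n C L \<and> (\<forall>D. D \<subset> C \<longrightarrow> \<not> uniquely_completable n D L)"

definition intercalate :: "array \<Rightarrow> array \<Rightarrow> bool" where
  "intercalate L I \<longleftrightarrow> I \<subseteq> L \<and>
     (\<exists>r\<^sub>1 r\<^sub>2 c\<^sub>1 c\<^sub>2 a b. r\<^sub>1 \<noteq> r\<^sub>2 \<and> c\<^sub>1 \<noteq> c\<^sub>2 \<and>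
        I = {(r\<^sub>1, c\<^sub>1, a), (r\<^sub>1, c\<^sub>2, b), (r\<^sub>2, c\<^sub>1, b), (r\<^sub>2, c\<^sub>2, a)})"

definition two_critical :: "nat \<Rightarrow> array \<Rightarrow> array \<Rightarrow> bool" where
  "two_critical n C L \<longleftrightarrow>
     critical_set n C L \<and> (\<forall>x\<in>C. \<exists>I. intercalate L I \<and> C \<inter> I = {x})"

definition greedy_cells :: "nat \<Rightarrow> (nat \<times> nat) list" where
  "greedy_cells n = [(x, y). x \<leftarrow> rev [0..<n], y \<leftarrow> rev [0..<n]]"

definition greedy_step :: "nat \<Rightarrow> array \<Rightarrow> nat \<times> nat \<Rightarrow> array \<Rightarrow> array" where
  "greedy_step n L = (\<lambda>(x, y) P.
     let Q = P - {(x, y, z) | z. (x, y, z) \<in> P}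
     in if uniquely_completable n Q L then Q else P)"

definition gcs :: "nat \<Rightarrow> array \<Rightarrow> array" where
  "gcs n L = fold (greedy_step n L) (greedy_cells n) L"

definition row_symbols :: "array \<Rightarrow> nat \<Rightarrow> nat set" where
  "row_symbols P r = {e. \<exists>c. (r, c, e) \<in> P}"

definition column_symbols :: "array \<Rightarrow> nat \<Rightarrow> nat set" where
  "column_symbols P c = {e. \<exists>r. (r, c, e) \<in> P}"

definition empty_cell :: "nat \<Rightarrow> array \<Rightarrow> nat \<Rightarrow> nat \<Rightarrow> bool" where
  "empty_cell n P r c \<longleftrightarrow> r < n \<and> c < n \<and> (\<forall>e. (r, c, e) \<notin> P)"

definition alternatives :: "nat \<Rightarrow> array \<Rightarrow> nat \<Rightarrow> nat \<Rightarrow> nat set" where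
  "alternatives n P r c = {..<n} - (row_symbols P r \<union> column_symbols P c)"

definition strong_completion :: "nat \<Rightarrow> array \<Rightarrow> array \<Rightarrow> bool" where
  "strong_completion n P L \<longleftrightarrow>
     uniquely_completable n P L \<and>
     (\<exists>Q :: nat \<Rightarrow> array. Q 0 = P \<and> Q (n\<^sup>2 - card P) = L \<and>
        (\<forall>t < n\<^sup>2 - card P. \<exists>r c e.
           empty_cell n (Q t) r c \<and> alternatives n (Q t) r c = {e} \<and>
           Q (Suc t) = insert (r, c, e) (Q t)))"

definition row_part :: "array \<Rightarrow> nat \<Rightarrow> array" where
  "row_part P i = {(r, c, e) \<in> P. r = i}"

definition rows_above :: "array \<Rightarrow> nat \<Rightarrow> array" where
  "rows_above P i = {(r, c, e) \<in> P. r < i}"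

text \<open>
  The array \<open>R\<close> is a way of filling row \<open>i\<close> of \<open>P\<close> completely: it keeps the entries that \<open>P\<close> has
  in that row, and is compatible with all of \<open>P\<close> (also with its entries below row \<open>i\<close>). It is not
  required that the result can be completed to a latin square.
\<close>

definition row_extension :: "nat \<Rightarrow> array \<Rightarrow> nat \<Rightarrow> array \<Rightarrow> bool" where
  "row_extension n P i R \<longleftrightarrow>
     R \<subseteq> {i} \<times> {..<n} \<times> {..<n} \<and>
     row_part P i \<subseteq> R \<and>
     (\<forall>c<n. \<exists>e. (i, c, e) \<in> R) \<and>
     partial_latin_square n (P \<union> R)"

definition completes_top_down :: "nat \<Rightarrow> array \<Rightarrow> array \<Rightarrow> bool" where
  "completes_top_down n P L \<longleftrightarrow>
     latin_square n L \<and> P \<subseteq> L \<and>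
     (\<forall>i<n. \<forall>R. row_extension n (P \<union> rows_above L i) i R \<longleftrightarrow> R = row_part L i)"

definition xor_square :: "nat \<Rightarrow> array" where
  "xor_square s = {(x, y, xor x y) | x y. x < 2 ^ s \<and> y < 2 ^ s}"

definition permute_rows :: "(nat \<Rightarrow> nat) \<Rightarrow> array \<Rightarrow> array" where
  "permute_rows \<alpha> L = {(\<alpha> r, c, e) | r c e. (r, c, e) \<in> L}"

end

theory Submission
  imports Defs
begin

text \<open>
  Intercalates of the permuted square are given by two rows and the columns \<open>y\<close>, \<open>y \<oplus> d\<close>, where \<open>d\<close>
  is the sum of the row elements. Guess the set of holes of the greedy critical set and check two
  things. (1) Every non-hole is the first cell, in reading order, of an intercalate whose three other
  cells are holes. (2) Within each row, the relation ``the symbol of hole \<open>y'\<close> is still possible at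
  hole \<open>y\<close> once all rows above are filled'' is acyclic. By (2) some hole of the first unfilled row is
  always forced, which gives unique, strong and top down completion. By (1) the greedy procedure
  cannot drop a non-hole, and by (2) it can drop every hole, so the guess is right and is 2-critical.

  Reading bit strings as sets, the holes of row \<open>v\<close> in the unpermuted square are the supersets of the
  complement of \<open>v\<close>, and the same set works whenever the row order extends inclusion. The
  transpositions in question violate inclusion in at most two pairs, and only the rows involved and
  those contained in the smaller element of a violated pair have different holes.
\<close>

subsection \<open>Latin squares\<close>

text \<open>One partner row governs both checks: the symbol of row \<open>v\<close>, column
  \<open>y'\<close> occurs in column \<open>y\<close> in row \<open>xor v (xor y y')\<close>. For
  two usual holes the partner is contained in \<open>v\<close>, so an order extending inclusion puts
  it above \<open>v\<close> and no symbol can move. For a non-hole, \<open>y'\<close> adds the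
  complement of \<open>v\<close> to \<open>y\<close>, and the partner properly contains
  \<open>v\<close>. A swap of rows puts some partners on the wrong side. A non-hole that relied on
  one must find a substitute partner or become a hole, and each change of the holes of one row
  affects the rows that use it as a partner. The irregular clauses of the hole sets and the ranks
  record how this settles. The hypotheses leave the residues 01, 23, 02, 12 and 13 mod 4 for
  \<open>k\<close>, \<open>k'\<close>; distance 3 rules out 03. Rows with residues 1 and 2 are
  incomparable sets, so 12 keeps the order compatible with inclusion. For 01, 23 and 02 a small set
  comes too late; for 13 a large set comes ahead of two of its subsets.\<close>

lemma latin_square_ex1:
  assumes "latin_square n L"
  shows latin_square_cell_ex1: "\<lbrakk>r < n; c < n\<rbrakk> \<Longrightarrow> \<exists>!e. (r, c, e) \<in> L"
    and latin_square_row_ex1: "\<lbrakk>r < n; e < n\<rbrakk> \<Longrightarrow> \<exists>!c. (r, c, e) \<in> L"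
    and latin_square_column_ex1: "\<lbrakk>c < n; e < n\<rbrakk> \<Longrightarrow> \<exists>!r. (r, c, e) \<in> L"
  using assms by (simp_all add: latin_square_def)

lemma latin_square_bounds:
  assumes "latin_square n L" and "(r, c, e) \<in> L"
  shows "r < n" "c < n" "e < n"
proof -
  have "L \<subseteq> {..<n} \<times> {..<n} \<times> {..<n}" using assms(1) by (simp add: latin_square_def)
  then show "r < n" "c < n" "e < n" using assms(2) by auto
qed

lemma latin_square_cell_unique:
  "e = e'" if "latin_square n L" "(r, c, e) \<in> L" "(r, c, e') \<in> L"
  using that latin_square_bounds[OF that(1,2)] latin_square_cell_ex1[OF that(1), of r c] by blast

lemma latin_square_row_unique:
  "c = c'" if "latin_square n L" "(r, c, e) \<in> L" "(r, c', e) \<in> L"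
  using that latin_square_bounds[OF that(1,2)] latin_square_row_ex1[OF that(1), of r e] by blast

lemma latin_square_column_unique:
  "r = r'" if "latin_square n L" "(r, c, e) \<in> L" "(r', c, e) \<in> L"
  using that latin_square_bounds[OF that(1,2)] latin_square_column_ex1[OF that(1), of c e] by blast

lemma latin_square_ex:
  assumes "latin_square n L"
  shows latin_square_cell_ex: "\<lbrakk>r < n; c < n\<rbrakk> \<Longrightarrow> \<exists>e. (r, c, e) \<in> L"
    and latin_square_row_ex: "\<lbrakk>r < n; e < n\<rbrakk> \<Longrightarrow> \<exists>c. (r, c, e) \<in> L"
    and latin_square_column_ex: "\<lbrakk>c < n; e < n\<rbrakk> \<Longrightarrow> \<exists>r. (r, c, e) \<in> L"
  using latin_square_ex1[OF assms] by (simp_all add: ex1_implies_ex)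

lemma latin_square_partial: "partial_latin_square n P" if "latin_square n L" "P \<subseteq> L"
proof -
  have "P \<subseteq> {..<n} \<times> {..<n} \<times> {..<n}"
    using that by (simp add: latin_square_def subset_trans[of P L])
  moreover have "e = e'" if "(r, c, e) \<in> P" "(r, c, e') \<in> P" for r c e e'
    using that \<open>P \<subseteq> L\<close> latin_square_cell_unique[OF \<open>latin_square n L\<close>] by blast
  moreover have "c = c'" if "(r, c, e) \<in> P" "(r, c', e) \<in> P" for r c c' e
    using that \<open>P \<subseteq> L\<close> latin_square_row_unique[OF \<open>latin_square n L\<close>] by blast
  moreover have "r = r'" if "(r, c, e) \<in> P" "(r', c, e) \<in> P" for r r' c e
    using that \<open>P \<subseteq> L\<close> latin_square_column_unique[OF \<open>latin_square n L\<close>] by blast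
  ultimately show ?thesis unfolding partial_latin_square_def by blast
qed

lemma latin_square_finite: "finite L" if "latin_square n L"
  by (rule finite_subset[of _ "{..<n} \<times> {..<n} \<times> {..<n}"])
     (use that in \<open>simp_all add: latin_square_def\<close>)

lemma latin_square_eqI:
  assumes "latin_square n L" "latin_square n L'" "L \<subseteq> L'"
  shows "L = L'"
proof
  show "L' \<subseteq> L"
  proof
    fix t assume t: "t \<in> L'"
    obtain r c e where [simp]: "t = (r, c, e)" by (cases t)
    obtain e' where "(r, c, e') \<in> L"
      using latin_square_cell_ex[OF assms(1), of r c] latin_square_bounds[OF assms(2), of r c e] t
      by auto
    then show "t \<in> L"
      using t assms(3) by (auto dest: latin_square_cell_unique[OF assms(2)])
  qed
qed (rule assms(3))

lemma latin_square_card: "card L = n\<^sup>2" if "latin_square n L"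
proof -
  have "bij_betw (\<lambda>(r, c, e). (r, c)) L ({..<n} \<times> {..<n})"
    unfolding bij_betw_def
  proof
    show "inj_on (\<lambda>(r, c, e). (r, c)) L"
      by (auto simp: inj_on_def dest: latin_square_cell_unique[OF that])
    show "(\<lambda>(r, c, e). (r, c)) ` L = {..<n} \<times> {..<n}"
    proof (rule set_eqI, clarify)
      fix r c
      show "(r, c) \<in> (\<lambda>(r, c, e). (r, c)) ` L \<longleftrightarrow> (r, c) \<in> {..<n} \<times> {..<n}"
        using latin_square_cell_ex[OF that, of r c] latin_square_bounds[OF that, of r c] by force
    qed
  qed
  then show ?thesis
    by (metis bij_betw_same_card card_cartesian_product card_lessThan power2_eq_square)
qed

text \<open>
  If the rows above row \<open>r\<close> are filled, another symbol that could go into the empty cell \<open>(r, c)\<close> is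
  the symbol of an empty cell \<open>(r, c')\<close> and of an empty cell \<open>(r', c)\<close> below. When \<open>f\<close> decreases along
  every such pair \<open>c, c'\<close>, an empty cell of least rank in the first unfilled row is forced.
\<close>

locale ranked_subset =
  fixes n :: nat and L C :: array and f :: "nat \<Rightarrow> nat \<Rightarrow> nat"
  assumes latin: "latin_square n L" and subset: "C \<subseteq> L"
    and rank: "\<And>r r' c c' e e'. \<lbrakk>(r, c, e') \<in> L - C; (r, c', e) \<in> L - C; (r', c, e) \<in> L - C; r < r'\<rbrakk>
      \<Longrightarrow> f r c' < f r c"
begin

text \<open>\<open>P\<close> is arbitrary because it is used three times: as the agreement with a
  rival latin square, as a stage of the filling, and as the agreement with a proposed row.\<close>

lemma forced_cell:
  assumes "C \<subseteq> P" "P \<subseteq> L" and above: "\<And>r c e. \<lbrakk>(r, c, e) \<in> L; r < i\<rbrakk> \<Longrightarrow> (r, c, e) \<in> P"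
    and hole: "\<exists>c e. (i, c, e) \<in> L - P"
  obtains c e where "(i, c, e) \<in> L - P" "alternatives n P i c = {e}"
proof -
  obtain c where c: "\<exists>e. (i, c, e) \<in> L - P"
    and least: "\<And>c'. \<exists>e. (i, c', e) \<in> L - P \<Longrightarrow> f i c \<le> f i c'"
    using ex_has_least_nat[of "\<lambda>c. \<exists>e. (i, c, e) \<in> L - P" _ "f i"] hole by blast
  from c obtain e where e: "(i, c, e) \<in> L - P" by blast
  then have b: "i < n" "c < n" "e < n" using latin_square_bounds[OF latin] by auto
  have "e \<in> alternatives n P i c"
    using b e \<open>P \<subseteq> L\<close>
    by (auto simp: alternatives_def row_symbols_def column_symbols_def
        dest: latin_square_row_unique[OF latin] latin_square_column_unique[OF latin] subsetD)
  moreover have "x = e" if x: "x \<in> alternatives n P i c" for x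
  proof (rule ccontr)
    assume "x \<noteq> e"
    from x have "x < n" and no: "\<And>c'. (i, c', x) \<notin> P" "\<And>r. (r, c, x) \<notin> P"
      by (auto simp: alternatives_def row_symbols_def column_symbols_def)
    then obtain c' r where c': "(i, c', x) \<in> L" and r: "(r, c, x) \<in> L"
      using latin_square_row_ex[OF latin] latin_square_column_ex[OF latin] b by meson
    have "\<not> r < i" using above r no by blast
    moreover have "r \<noteq> i" using r e \<open>x \<noteq> e\<close> latin_square_cell_unique[OF latin] by blast
    ultimately have "f i c' < f i c"
      using rank[of i c e c' x r] e c' r no \<open>C \<subseteq> P\<close> by auto
    moreover have "f i c \<le> f i c'" using least c' no by blast
    ultimately show False by simp
  qed
  ultimately have "alternatives n P i c = {e}" by blast
  with e that show thesis by blast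
qed

lemma forced_cell_ex:
  assumes "C \<subseteq> P" "P \<subset> L"
  obtains r c e where "(r, c, e) \<in> L - P" "alternatives n P r c = {e}"
proof -
  have "\<exists>r c e. (r, c, e) \<in> L - P" using assms(2) by auto
  then obtain i where "\<exists>c e. (i, c, e) \<in> L - P"
    and "\<And>r. r < i \<Longrightarrow> \<not> (\<exists>c e. (r, c, e) \<in> L - P)"
    using exists_least_iff[of "\<lambda>i. \<exists>c e. (i, c, e) \<in> L - P"] by blast
  then obtain c e where "(i, c, e) \<in> L - P" "alternatives n P i c = {e}"
    using forced_cell[of P i] assms by (metis DiffI psubset_imp_subset)
  then show thesis by (rule that)
qed

text \<open>For a rival completion \<open>L'\<close> the forced cell is taken with respect to
  \<open>L \<inter> L'\<close>. The entry of \<open>L'\<close> there is not shared, and as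
  \<open>L'\<close> is latin its symbol occurs nowhere in that row or column of the intersection; it
  would be a second alternative.\<close>

lemma uniquely_completable: "uniquely_completable n C L"
proof -
  have "L' = L" if L': "latin_square n L'" "C \<subseteq> L'" for L'
  proof (rule ccontr)
    assume "L' \<noteq> L"
    then have "L \<inter> L' \<subset> L" using latin_square_eqI[OF latin L'(1)] by blast
    then obtain r c e where e: "(r, c, e) \<in> L - L \<inter> L'" "alternatives n (L \<inter> L') r c = {e}"
      using forced_cell_ex[of "L \<inter> L'"] subset L' by blast
    then have b: "r < n" "c < n" using latin_square_bounds[OF latin] by auto
    then obtain x where x: "(r, c, x) \<in> L'" using latin_square_cell_ex[OF L'(1)] by blast
    then have "x \<noteq> e" using e by blast
    then have xL: "(r, c, x) \<notin> L" using e latin_square_cell_unique[OF latin] by blast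
    have "x \<in> alternatives n (L \<inter> L') r c"
      using latin_square_bounds[OF L'(1) x] x xL
      by (auto simp: alternatives_def row_symbols_def column_symbols_def
          dest: latin_square_row_unique[OF L'(1)] latin_square_column_unique[OF L'(1)])
    then show False using e \<open>x \<noteq> e\<close> by simp
  qed
  then show ?thesis using latin subset unfolding uniquely_completable_def by blast
qed

section \<open>Strong and top down completion from forced cells\<close>

definition forced_step :: "array \<Rightarrow> array \<Rightarrow> bool" where
  "forced_step P P' \<longleftrightarrow> (\<exists>r c e.
     empty_cell n P r c \<and> alternatives n P r c = {e} \<and> P' = insert (r, c, e) P)"

lemma filling_chain:
  assumes "C \<subseteq> P" "P \<subseteq> L" "card (L - P) = m"
  shows "\<exists>Q. Q 0 = P \<and> Q m = L \<and> (\<forall>t<m. forced_step (Q t) (Q (Suc t)))"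
  using assms
proof (induction m arbitrary: P)
  case 0
  then have "P = L" using latin_square_finite[OF latin] by auto
  then show ?case by auto
next
  case (Suc m)
  then have "P \<subset> L" by auto
  then obtain r c e where e: "(r, c, e) \<in> L - P" "alternatives n P r c = {e}"
    using forced_cell_ex[OF Suc.prems(1)] by metis
  let ?P = "insert (r, c, e) P"
  have "L - P = insert (r, c, e) (L - ?P)" using e by blast
  then have "card (L - P) = Suc (card (L - ?P))"
    using card_insert_disjoint[of "L - ?P" "(r, c, e)"] latin_square_finite[OF latin]
    by (metis DiffD2 finite_Diff insertI1)
  then have "card (L - ?P) = m" using Suc.prems(3) by linarith
  moreover have "C \<subseteq> ?P" "?P \<subseteq> L" using Suc.prems e by auto
  ultimately obtain Q where Q: "Q 0 = ?P" "Q m = L" "\<forall>t<m. forced_step (Q t) (Q (Suc t))"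
    using Suc.IH[of ?P] by metis
  have "empty_cell n P r c"
    using e Suc.prems(2)
    by (auto simp: empty_cell_def dest: latin_square_bounds[OF latin] latin_square_cell_unique[OF latin])
  then have "forced_step P ?P" using e by (auto simp: forced_step_def)
  then show ?case
    using Q by (intro exI[of _ "case_nat P Q"]) (auto split: nat.split simp: less_Suc_eq_0_disj)
qed

lemma strong_completion: "strong_completion n C L"
proof -
  have "card (L - C) = n\<^sup>2 - card C"
    using subset latin_square_card[OF latin] latin_square_finite[OF latin]
    by (simp add: card_Diff_subset finite_subset)
  then show ?thesis
    using filling_chain[of C] subset uniquely_completable
    unfolding strong_completion_def forced_step_def by simp
qed

text \<open>\<open>R\<close> need not extend to a latin square, so unique completability does not
  apply. The forced cell argument is run on \<open>C\<close>, the full rows above and the part of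
  \<open>R\<close> that agrees with \<open>L\<close>; since \<open>R\<close> is compatible with all
  given entries, a deviating symbol would be a second alternative.\<close>

lemma row_extension_unique:
  assumes "i < n" "row_extension n (C \<union> rows_above L i) i R"
  shows "R = row_part L i"
proof -
  let ?T = "C \<union> rows_above L i"
  let ?P = "?T \<union> (R \<inter> L)"
  have R: "R \<subseteq> {i} \<times> {..<n} \<times> {..<n}" "\<And>c. c < n \<Longrightarrow> \<exists>e. (i, c, e) \<in> R"
    "partial_latin_square n (?T \<union> R)"
    using assms(2) by (auto simp: row_extension_def)
  have pls: "e = e'" if "(r, c, e) \<in> ?T \<union> R" "(r, c, e') \<in> ?T \<union> R" for r c e e'
    using R(3) that unfolding partial_latin_square_def by meson
  have pls_row: "c = c'" if "(r, c, e) \<in> ?T \<union> R" "(r, c', e) \<in> ?T \<union> R" for r c c' e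
    using R(3) that unfolding partial_latin_square_def by meson
  have pls_column: "r = r'" if "(r, c, e) \<in> ?T \<union> R" "(r', c, e) \<in> ?T \<union> R" for r r' c e
    using R(3) that unfolding partial_latin_square_def by meson
  have TL: "?T \<subseteq> L" using subset by (auto simp: rows_above_def)
  have PL: "C \<subseteq> ?P" "?P \<subseteq> L" using TL by auto
  have above: "(r, c, e) \<in> ?P" if "(r, c, e) \<in> L" "r < i" for r c e
    using that by (simp add: rows_above_def)
  have "\<not> (\<exists>c e. (i, c, e) \<in> L - ?P)"
  proof
    assume "\<exists>c e. (i, c, e) \<in> L - ?P"
    then obtain c e where e: "(i, c, e) \<in> L - ?P" "alternatives n ?P i c = {e}"
      by (rule forced_cell[OF PL above, rotated 2])
    then have "c < n" using latin_square_bounds[OF latin] by auto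
    then obtain x where x: "(i, c, x) \<in> R" using R by blast
    then have "x \<noteq> e" using e by blast
    then have "(i, c, x) \<notin> L" using e latin_square_cell_unique[OF latin] by blast
    then have xP: "(i, c, x) \<notin> ?P" using TL by blast
    have "(i, c', x) \<notin> ?P" for c'
      using pls_row[of i c x c'] x xP by blast
    moreover have "(r, c, x) \<notin> ?P" for r
      using pls_column[of i c x r] x xP by blast
    ultimately have "x \<in> alternatives n ?P i c"
      using x R(1) by (auto simp: alternatives_def row_symbols_def column_symbols_def)
    then show False using e \<open>x \<noteq> e\<close> by simp
  qed
  then have row: "(i, c, e) \<in> ?P" if "(i, c, e) \<in> L" for c e using that by blast
  have TR: "row_part ?T i \<subseteq> R" using assms(2) by (simp add: row_extension_def)
  have LR: "row_part L i \<subseteq> R"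
  proof
    fix t assume "t \<in> row_part L i"
    then obtain c e where t: "t = (i, c, e)" "(i, c, e) \<in> L" by (auto simp: row_part_def)
    then have "t \<in> row_part ?T i \<or> t \<in> R" using row[of c e] by (simp add: row_part_def)
    then show "t \<in> R" using TR by blast
  qed
  have "R \<subseteq> row_part L i"
  proof
    fix t assume t: "t \<in> R"
    then obtain c x where [simp]: "t = (i, c, x)" and "c < n" using R(1) by auto
    then obtain e where e: "(i, c, e) \<in> L"
      using latin_square_cell_ex[OF latin] assms(1) by blast
    then have "(i, c, e) \<in> R" using LR by (auto simp: row_part_def)
    then have "e = x" using t pls[of i c e x] by auto
    then show "t \<in> row_part L i" using e by (simp add: row_part_def)
  qed
  then show ?thesis using LR by blast
qed

lemma completes_top_down: "completes_top_down n C L"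
proof -
  have "row_extension n (C \<union> rows_above L i) i (row_part L i)" if "i < n" for i
  proof -
    have "C \<union> rows_above L i \<union> row_part L i \<subseteq> L"
      using subset by (auto simp: rows_above_def row_part_def)
    moreover have "row_part (C \<union> rows_above L i) i \<subseteq> row_part L i"
      using subset by (auto simp: row_part_def rows_above_def)
    ultimately show ?thesis
      using latin_square_partial[OF latin] latin_square_cell_ex[OF latin that]
      unfolding row_extension_def
      by (auto simp: row_part_def dest: latin_square_bounds[OF latin])
  qed
  then have "row_extension n (C \<union> rows_above L i) i R \<longleftrightarrow> R = row_part L i" if "i < n" for i R
    using row_extension_unique[OF that, of R] that by metis
  then show ?thesis using latin subset unfolding completes_top_down_def by simp
qed

end

subsection \<open>Greedy critical sets\<close>

text \<open>Interchanging the two symbols of \<open>I\<close> gives a second latin square, which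
  contains every subset of \<open>L\<close> disjoint from \<open>I\<close>.\<close>

lemma intercalate_trade:
  assumes L: "latin_square n L" and "intercalate L I" and "Q \<inter> I = {}"
  shows "\<not> uniquely_completable n Q L"
proof
  assume uc: "uniquely_completable n Q L"
  obtain r\<^sub>1 r\<^sub>2 c\<^sub>1 c\<^sub>2 a b where "r\<^sub>1 \<noteq> r\<^sub>2" "c\<^sub>1 \<noteq> c\<^sub>2" "I \<subseteq> L" and
    I: "I = {(r\<^sub>1, c\<^sub>1, a), (r\<^sub>1, c\<^sub>2, b), (r\<^sub>2, c\<^sub>1, b), (r\<^sub>2, c\<^sub>2, a)}"
    using assms(2) unfolding intercalate_def by (elim conjE exE) (rule that)
  define S where "S = {(r\<^sub>1, c\<^sub>1, b), (r\<^sub>1, c\<^sub>2, a), (r\<^sub>2, c\<^sub>1, a), (r\<^sub>2, c\<^sub>2, b)}"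
  have IL: "(r\<^sub>1, c\<^sub>1, a) \<in> L" "(r\<^sub>1, c\<^sub>2, b) \<in> L" "(r\<^sub>2, c\<^sub>1, b) \<in> L" "(r\<^sub>2, c\<^sub>2, a) \<in> L"
    using \<open>I \<subseteq> L\<close> by (auto simp: I)
  have "a \<noteq> b" using latin_square_row_unique[OF L IL(1), of c\<^sub>2] IL(2) \<open>c\<^sub>1 \<noteq> c\<^sub>2\<close> by blast
  have sub: "S \<subseteq> {..<n} \<times> {..<n} \<times> {..<n}"
    using latin_square_bounds[OF L IL(1)] latin_square_bounds[OF L IL(2)]
      latin_square_bounds[OF L IL(3)] by (simp add: S_def)
  define L' where "L' = L - I \<union> S"
  have cell: "(r\<^sub>1, c\<^sub>1, e) \<in> L \<longleftrightarrow> e = a" "(r\<^sub>1, c\<^sub>2, e) \<in> L \<longleftrightarrow> e = b"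
    "(r\<^sub>2, c\<^sub>1, e) \<in> L \<longleftrightarrow> e = b" "(r\<^sub>2, c\<^sub>2, e) \<in> L \<longleftrightarrow> e = a" for e
    using IL latin_square_cell_unique[OF L] by metis+
  have row: "(r\<^sub>1, c, a) \<in> L \<longleftrightarrow> c = c\<^sub>1" "(r\<^sub>1, c, b) \<in> L \<longleftrightarrow> c = c\<^sub>2"
    "(r\<^sub>2, c, b) \<in> L \<longleftrightarrow> c = c\<^sub>1" "(r\<^sub>2, c, a) \<in> L \<longleftrightarrow> c = c\<^sub>2" for c
    using IL latin_square_row_unique[OF L] by metis+
  have column: "(r, c\<^sub>1, a) \<in> L \<longleftrightarrow> r = r\<^sub>1" "(r, c\<^sub>2, b) \<in> L \<longleftrightarrow> r = r\<^sub>1"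
    "(r, c\<^sub>1, b) \<in> L \<longleftrightarrow> r = r\<^sub>2" "(r, c\<^sub>2, a) \<in> L \<longleftrightarrow> r = r\<^sub>2" for r
    using IL latin_square_column_unique[OF L] by metis+
  note distinct = \<open>r\<^sub>1 \<noteq> r\<^sub>2\<close> \<open>c\<^sub>1 \<noteq> c\<^sub>2\<close> \<open>a \<noteq> b\<close>
  note distinct = distinct distinct[symmetric]
  \<comment> \<open>Once two of the three coordinates are fixed, the matching entries of
    \<open>L'\<close> come entirely from \<open>S\<close> or entirely from \<open>L\<close>. The
    three descriptions serve the three uniqueness clauses of a latin square.\<close>
  have iff: "(r, c, e) \<in> L' \<longleftrightarrow>
    (if r \<in> {r\<^sub>1, r\<^sub>2} \<and> c \<in> {c\<^sub>1, c\<^sub>2} then (r, c, e) \<in> S else (r, c, e) \<in> L)" for r c e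
    by (cases "r = r\<^sub>1"; cases "r = r\<^sub>2"; cases "c = c\<^sub>1"; cases "c = c\<^sub>2")
       (simp_all add: L'_def I S_def cell distinct)
  have iff_row: "(r, c, e) \<in> L' \<longleftrightarrow>
    (if r \<in> {r\<^sub>1, r\<^sub>2} \<and> e \<in> {a, b} then (r, c, e) \<in> S else (r, c, e) \<in> L)" for r c e
    by (cases "r = r\<^sub>1"; cases "r = r\<^sub>2"; cases "e = a"; cases "e = b")
       (simp_all add: L'_def I S_def row distinct)
  have iff_column: "(r, c, e) \<in> L' \<longleftrightarrow>
    (if c \<in> {c\<^sub>1, c\<^sub>2} \<and> e \<in> {a, b} then (r, c, e) \<in> S else (r, c, e) \<in> L)" for r c e
    by (cases "c = c\<^sub>1"; cases "c = c\<^sub>2"; cases "e = a"; cases "e = b")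
       (simp_all add: L'_def I S_def column distinct)
  have "latin_square n L'"
    unfolding latin_square_def
  proof (intro conjI allI impI)
    show "L' \<subseteq> {..<n} \<times> {..<n} \<times> {..<n}"
      using sub L unfolding L'_def latin_square_def by (meson Diff_subset Un_least subset_trans)
  next
    fix r c assume "r < n" "c < n"
    have "\<exists>!e. (r, c, e) \<in> S" if "r \<in> {r\<^sub>1, r\<^sub>2}" "c \<in> {c\<^sub>1, c\<^sub>2}"
      using that \<open>r\<^sub>1 \<noteq> r\<^sub>2\<close> \<open>c\<^sub>1 \<noteq> c\<^sub>2\<close> by (auto simp: S_def)
    then show "\<exists>!e. (r, c, e) \<in> L'"
      using latin_square_cell_ex1[OF L \<open>r < n\<close> \<open>c < n\<close>]
      by (cases "r \<in> {r\<^sub>1, r\<^sub>2} \<and> c \<in> {c\<^sub>1, c\<^sub>2}") (simp_all only: iff if_True if_False simp_thms)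
  next
    fix r e assume "r < n" "e < n"
    have "\<exists>!c. (r, c, e) \<in> S" if "r \<in> {r\<^sub>1, r\<^sub>2}" "e \<in> {a, b}"
      using that \<open>r\<^sub>1 \<noteq> r\<^sub>2\<close> \<open>a \<noteq> b\<close> by (auto simp: S_def)
    then show "\<exists>!c. (r, c, e) \<in> L'"
      using latin_square_row_ex1[OF L \<open>r < n\<close> \<open>e < n\<close>]
      by (cases "r \<in> {r\<^sub>1, r\<^sub>2} \<and> e \<in> {a, b}") (simp_all only: iff_row if_True if_False simp_thms)
  next
    fix c e assume "c < n" "e < n"
    have "\<exists>!r. (r, c, e) \<in> S" if "c \<in> {c\<^sub>1, c\<^sub>2}" "e \<in> {a, b}"
      using that \<open>c\<^sub>1 \<noteq> c\<^sub>2\<close> \<open>a \<noteq> b\<close> by (auto simp: S_def)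
    then show "\<exists>!r. (r, c, e) \<in> L'"
      using latin_square_column_ex1[OF L \<open>c < n\<close> \<open>e < n\<close>]
      by (cases "c \<in> {c\<^sub>1, c\<^sub>2} \<and> e \<in> {a, b}") (simp_all only: iff_column if_True if_False simp_thms)
  qed
  moreover have "Q \<subseteq> L'"
    using uc assms(3) unfolding uniquely_completable_def L'_def by blast
  ultimately have "L' = L" using uc unfolding uniquely_completable_def by blast
  moreover have "(r\<^sub>1, c\<^sub>1, b) \<in> L'" by (simp add: L'_def S_def)
  ultimately show False
    using latin_square_cell_unique[OF L IL(1), of b] \<open>a \<noteq> b\<close> by blast
qed

lemma uniquely_completable_mono:
  "uniquely_completable n Q L" if "uniquely_completable n P L" "P \<subseteq> Q" "Q \<subseteq> L"
  using that unfolding uniquely_completable_def by (meson subset_trans)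

section \<open>The greedy scan\<close>

lemma greedy_cells_sorted:
  "sorted_wrt (\<lambda>(x, y) (x', y'). x' < x \<or> x' = x \<and> y' < y) (greedy_cells n)"
proof -
  \<comment> \<open>The number of rows is separated from the row length, so that the induction can
    strip one row at a time.\<close>
  have "sorted_wrt (\<lambda>(x, y) (x', y'). x' < x \<or> x' = x \<and> y' < y)
    [(x, y). x \<leftarrow> rev [0..<m], y \<leftarrow> rev [0..<n]]" for m
  proof (induction m)
    case (Suc m)
    have "sorted_wrt (\<lambda>(x, y) (x', y'). x' < x \<or> x' = x \<and> y' < y) (map (Pair m) (rev [0..<n]))"
      by (simp add: sorted_wrt_map sorted_wrt_rev)
    then show ?case
      using Suc.IH by (auto simp: sorted_wrt_append)
  qed simp
  then show ?thesis by (simp add: greedy_cells_def)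
qed

lemma set_greedy_cells: "set (greedy_cells n) = {..<n} \<times> {..<n}"
  by (auto simp: greedy_cells_def)

text \<open>Invariant: what remains is \<open>C\<close> and the cells not yet visited. When a cell
  of \<open>C\<close> is reached, the rest of its intercalate is later in reading order, hence
  visited, and being outside \<open>C\<close> is gone; removing the cell would permit the trade.
  Removing any other cell leaves a superset of \<open>C\<close>.\<close>

lemma gcs_eqI:
  assumes L: "latin_square n L" and uc: "uniquely_completable n C L"
    and I: "\<And>x y z. (x, y, z) \<in> C \<Longrightarrow> \<exists>I. intercalate L I \<and> C \<inter> I = {(x, y, z)} \<and>
      (\<forall>x' y' z'. (x', y', z') \<in> I \<longrightarrow> x < x' \<or> x = x' \<and> y \<le> y')"
  shows "gcs n L = C"
proof -
  have CL: "C \<subseteq> L" using uc by (simp add: uniquely_completable_def)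
  have inv: "fold (greedy_step n L) xs L = C \<union> {(x, y, z) \<in> L. (x, y) \<notin> set xs}"
    if "\<exists>ys. greedy_cells n = xs @ ys" for xs
    using that
  proof (induction xs rule: rev_induct)
    case Nil
    then show ?case using CL by auto
  next
    case (snoc p xs)
    obtain x y where p: "p = (x, y)" by (cases p)
    obtain ys where ys: "greedy_cells n = xs @ (x, y) # ys" using snoc.prems p by auto
    have "(x, y) \<in> set (greedy_cells n)" by (simp add: ys)
    then have xy: "x < n" "y < n" by (auto simp: set_greedy_cells)
    have later: "(x', y') \<in> set xs" if "x' < n" "y' < n" "x < x' \<or> x = x' \<and> y < y'" for x' y'
    proof -
      have "(x', y') \<in> set (greedy_cells n)" using that by (simp add: set_greedy_cells)
      moreover have "(x', y') \<notin> set ((x, y) # ys)"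
        using greedy_cells_sorted[of n] that unfolding ys by (auto simp: sorted_wrt_append)
      ultimately show ?thesis by (auto simp: ys)
    qed
    have new: "(x, y) \<notin> set xs"
      using greedy_cells_sorted[of n] unfolding ys by (auto simp: sorted_wrt_append)
    define P where "P = C \<union> {(x, y, z) \<in> L. (x, y) \<notin> set xs}"
    have fold: "fold (greedy_step n L) xs L = P"
      using snoc.IH ys by (simp add: P_def)
    define Q where "Q = P - {(x, y, z) | z. (x, y, z) \<in> P}"
    have "fold (greedy_step n L) (xs @ [p]) L = greedy_step n L (x, y) P"
      by (simp add: fold p)
    then have step:
      "fold (greedy_step n L) (xs @ [p]) L = (if uniquely_completable n Q L then Q else P)"
      by (simp add: greedy_step_def Q_def Let_def)
    obtain z where z: "(x, y, z) \<in> L" using latin_square_cell_ex[OF L xy] by blast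
    have PL: "P \<subseteq> L" using CL by (auto simp: P_def)
    have Q: "Q = P - {(x, y, z)}"
      using PL z by (auto simp: Q_def dest: latin_square_cell_unique[OF L])
    show ?case
    proof (cases "(x, y, z) \<in> C")
      case True
      then obtain I where I: "intercalate L I" "C \<inter> I = {(x, y, z)}"
        and first: "\<And>x' y' z'. (x', y', z') \<in> I \<Longrightarrow> x < x' \<or> x = x' \<and> y \<le> y'"
        using I by meson
      have "Q \<inter> I = {}"
      proof (rule ccontr)
        assume "Q \<inter> I \<noteq> {}"
        then obtain x' y' z' where t: "(x', y', z') \<in> Q" "(x', y', z') \<in> I" by auto
        then have "(x', y', z') \<in> L" using PL by (auto simp: Q)
        then have b: "x' < n" "y' < n" using latin_square_bounds[OF L] by auto
        have "(x', y', z') \<notin> C" using t I(2) unfolding Q by blast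
        then have "(x', y') \<notin> set xs" using t(1) by (auto simp: Q P_def)
        then have "x' = x \<and> y' = y" using later[OF b] first[OF t(2)] by (metis le_neq_implies_less)
        then have "z' = z" using \<open>(x', y', z') \<in> L\<close> z latin_square_cell_unique[OF L] by blast
        then show False using t(1) \<open>x' = x \<and> y' = y\<close> by (simp add: Q)
      qed
      then have "\<not> uniquely_completable n Q L" by (rule intercalate_trade[OF L I(1)])
      moreover have "P = C \<union> {(x, y, z) \<in> L. (x, y) \<notin> set (xs @ [p])}"
        using True z by (auto simp: P_def p dest: latin_square_cell_unique[OF L])
      ultimately show ?thesis by (simp only: step if_False)
    next
      case False
      then have "C \<subseteq> Q" by (auto simp: Q P_def)
      then have "uniquely_completable n Q L"
        using PL by (intro uniquely_completable_mono[OF uc]) (auto simp: Q)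
      moreover have "Q = C \<union> {(x, y, z) \<in> L. (x, y) \<notin> set (xs @ [p])}"
        using False z by (auto simp: P_def Q p dest: latin_square_cell_unique[OF L])
      ultimately show ?thesis by (simp only: step if_True)
    qed
  qed
  have "{(x, y, z) \<in> L. (x, y) \<notin> set (greedy_cells n)} = {}"
    by (auto simp: set_greedy_cells dest: latin_square_bounds[OF L])
  then show ?thesis unfolding gcs_def using inv[of "greedy_cells n"] by (simp only: append_Nil2) blast
qed

lemma two_criticalI:
  assumes L: "latin_square n L" and uc: "uniquely_completable n C L"
    and I: "\<And>t. t \<in> C \<Longrightarrow> \<exists>I. intercalate L I \<and> C \<inter> I = {t}"
  shows "two_critical n C L"
proof -
  have "\<not> uniquely_completable n D L" if D: "D \<subset> C" for D
  proof -
    obtain t where "t \<in> C" "t \<notin> D" using D by blast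
    then obtain I where "intercalate L I" "C \<inter> I = {t}" using I by meson
    moreover have "D \<inter> I \<subseteq> {t}"
      using psubset_imp_subset[OF D] \<open>C \<inter> I = {t}\<close> by (metis Int_mono subset_refl)
    then have "D \<inter> I = {}" using \<open>t \<notin> D\<close> by (metis Int_iff insertI1 subset_singletonD)
    ultimately show ?thesis using intercalate_trade[OF L] by metis
  qed
  then show ?thesis using uc I unfolding two_critical_def critical_set_def by blast
qed

subsection \<open>Row permutations of the xor square\<close>

lemma less_power2_iff: "x < 2 ^ s \<longleftrightarrow> (\<forall>i. bit x i \<longrightarrow> i < s)" for x :: nat
proof -
  have "x < 2 ^ s \<longleftrightarrow> take_bit s x = x" by (simp add: take_bit_nat_eq_self_iff)
  also have "\<dots> \<longleftrightarrow> (\<forall>i. bit x i \<longrightarrow> i < s)" by (auto simp: bit_eq_iff bit_take_bit_iff)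
  finally show ?thesis .
qed

lemma xor_less_power2: "xor x y < 2 ^ s" if "x < 2 ^ s" "y < 2 ^ s" for x y :: nat
  using that by (auto simp: less_power2_iff bit_xor_iff)

lemma xor_cancel: "xor (xor x y) y = x" "xor y (xor y x) = x" for x y :: nat
  by (auto simp: bit_eq_iff bit_xor_iff)

lemma permute_rows_xor_square:
  assumes "\<And>x. a (a x) = x" "\<And>x. x < 2 ^ s \<Longrightarrow> a x < 2 ^ s"
  shows "permute_rows a (xor_square s) = {(x, y, xor (a x) y) | x y. x < 2 ^ s \<and> y < 2 ^ s}"
proof -
  have "(x, y, z) \<in> permute_rows a (xor_square s) \<longleftrightarrow> x < 2 ^ s \<and> y < 2 ^ s \<and> z = xor (a x) y" for x y z
    unfolding permute_rows_def xor_square_def using assms by simp metis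
  then show ?thesis by auto
qed

lemma latin_square_permuted_xor:
  assumes a: "\<And>x. a (a x) = x" "\<And>x. x < 2 ^ s \<Longrightarrow> a x < 2 ^ s"
  shows "latin_square (2 ^ s) {(x, y, xor (a x) y) | x y. x < 2 ^ s \<and> y < 2 ^ s}"
  unfolding latin_square_def
proof (intro conjI allI impI)
  show "{(x, y, xor (a x) y) |x y. x < 2 ^ s \<and> y < 2 ^ s} \<subseteq> {..<2 ^ s} \<times> {..<2 ^ s} \<times> {..<2 ^ s}"
    using a(2) xor_less_power2 by auto
next
  fix x z :: nat assume "x < 2 ^ s" "z < 2 ^ s"
  then show "\<exists>!y. (x, y, z) \<in> {(x, y, xor (a x) y) |x y. x < 2 ^ s \<and> y < 2 ^ s}"
    by (intro ex1I[of _ "xor (a x) z"]) (auto simp: xor_cancel xor_less_power2 a(2))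
next
  fix y z :: nat assume "y < 2 ^ s" "z < 2 ^ s"
  then show "\<exists>!x. (x, y, z) \<in> {(x, y, xor (a x) y) |x y. x < 2 ^ s \<and> y < 2 ^ s}"
    by (intro ex1I[of _ "a (xor z y)"]) (auto simp: xor_cancel xor_less_power2 a)
qed auto

text \<open>
  A row is named by the element \<open>v\<close> for which it has \<open>v \<oplus> y\<close> in column \<open>y\<close>; its position is \<open>a v\<close>.
  \<open>E v y\<close> says that the critical set leaves the cell in row \<open>v\<close> and column \<open>y\<close> empty.
\<close>

lemma permuted_xor_square_criterion:
  fixes a :: "nat \<Rightarrow> nat" and E :: "nat \<Rightarrow> nat \<Rightarrow> bool" and f :: "nat \<Rightarrow> nat \<Rightarrow> nat"
  assumes a: "\<And>x. a (a x) = x" "\<And>x. x < 2 ^ s \<Longrightarrow> a x < 2 ^ s"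
    and L: "L = permute_rows a (xor_square s)"
    and intercalate: "\<And>v y. \<lbrakk>v < 2 ^ s; y < 2 ^ s; \<not> E v y\<rbrakk> \<Longrightarrow> \<exists>y'<2 ^ s. y < y' \<and> E v y' \<and>
      a v < a (xor v (xor y y')) \<and> E (xor v (xor y y')) y \<and> E (xor v (xor y y')) y'"
    and rank: "\<And>v y y'. \<lbrakk>v < 2 ^ s; y < 2 ^ s; y' < 2 ^ s; E v y; E v y';
      a v < a (xor v (xor y y')); E (xor v (xor y y')) y\<rbrakk> \<Longrightarrow> f v y' < f v y"
  shows "two_critical (2 ^ s) (gcs (2 ^ s) L) L \<and> strong_completion (2 ^ s) (gcs (2 ^ s) L) L \<and>
    completes_top_down (2 ^ s) (gcs (2 ^ s) L) L"
proof -
  have L_eq: "L = {(x, y, xor (a x) y) | x y. x < 2 ^ s \<and> y < 2 ^ s}"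
    using permute_rows_xor_square[OF a] L by simp
  have latin: "latin_square (2 ^ s) L"
    using latin_square_permuted_xor[OF a] by (simp add: L_eq)
  have in_L: "(x, y, z) \<in> L \<longleftrightarrow> x < 2 ^ s \<and> y < 2 ^ s \<and> z = xor (a x) y" for x y z
    by (auto simp: L_eq)
  define C where "C = {(x, y, z) \<in> L. \<not> E (a x) y}"
  have in_C: "(x, y, z) \<in> C \<longleftrightarrow> x < 2 ^ s \<and> y < 2 ^ s \<and> z = xor (a x) y \<and> \<not> E (a x) y" for x y z
    by (simp add: C_def in_L)
  interpret ranked_subset "2 ^ s" L C "\<lambda>x. f (a x)"
  proof
    show "C \<subseteq> L" by (auto simp: C_def)
    fix x x' y y' z z'
    assume *: "(x, y, z') \<in> L - C" "(x, y', z) \<in> L - C" "(x', y, z) \<in> L - C" "x < x'"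
    then have eq: "xor (a x) y' = xor (a x') y" by (simp add: in_L)
    \<comment> \<open>The only row with the symbol of cell (x, y') in column \<open>y\<close> is the
      partner of \<open>a x\<close>; in this form the rank assumption applies to it.\<close>
    have "a x' = xor (xor (a x') y) y" by (simp add: xor_cancel)
    also have "\<dots> = xor (xor (a x) y') y" by (simp only: eq)
    also have "\<dots> = xor (a x) (xor y y')" by (simp add: ac_simps)
    finally have x': "xor (a x) (xor y y') = a x'" ..
    show "f (a x) y' < f (a x) y"
      by (rule rank) (use * in \<open>simp_all add: x' a in_L in_C\<close>)
  qed (rule latin)
  have ex: "\<exists>I. intercalate L I \<and> C \<inter> I = {(x, y, z)} \<and>
      (\<forall>x' y' z'. (x', y', z') \<in> I \<longrightarrow> x < x' \<or> x = x' \<and> y \<le> y')" if t: "(x, y, z) \<in> C" for x y z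
  proof -
    have xy: "x < 2 ^ s" "y < 2 ^ s" "z = xor (a x) y" "\<not> E (a x) y" using t by (simp_all add: in_C)
    define v where "v = a x"
    have v: "v < 2 ^ s" "a v = x" "\<not> E v y" using xy by (simp_all add: v_def a)
    obtain y' where y': "y' < 2 ^ s" "y < y'" "E v y'" "x < a (xor v (xor y y'))"
      "E (xor v (xor y y')) y" "E (xor v (xor y y')) y'"
      using intercalate[OF v(1) xy(2) v(3)] v(2) by metis
    define w where "w = xor v (xor y y')"
    have w: "w < 2 ^ s" using v xy y' by (simp add: w_def xor_less_power2)
    \<comment> \<open>Row \<open>w\<close> carries the symbols of row \<open>v\<close> in columns
      \<open>y\<close> and \<open>y'\<close> interchanged, so the four cells form an
      intercalate.\<close>
    have wy: "xor w y = xor v y'" "xor w y' = xor v y"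
      by (simp_all add: w_def bit_eq_iff bit_xor_iff) blast+
    define I where "I = {(x, y, xor v y), (x, y', xor v y'), (a w, y, xor v y'), (a w, y', xor v y)}"
    have "I \<subseteq> L" using xy y' w by (auto simp: I_def in_L a wy v_def)
    moreover have "x \<noteq> a w" "y \<noteq> y'" using y' by (simp_all add: w_def)
    ultimately have "intercalate L I" unfolding intercalate_def I_def by blast
    moreover have "C \<inter> I = {(x, y, z)}"
      using t y' xy by (auto simp: I_def in_C a v_def[symmetric] w_def[symmetric])
    moreover have "\<forall>x' y' z'. (x', y', z') \<in> I \<longrightarrow> x < x' \<or> x = x' \<and> y \<le> y'"
      using y' by (auto simp: I_def w_def)
    ultimately show ?thesis by blast
  qed
  have "gcs (2 ^ s) L = C"
    by (rule gcs_eqI[OF latin uniquely_completable ex])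
  moreover have "two_critical (2 ^ s) C L"
  proof (rule two_criticalI[OF latin uniquely_completable])
    fix t assume "t \<in> C"
    then show "\<exists>I. intercalate L I \<and> C \<inter> I = {t}"
      using ex[of "fst t" "fst (snd t)" "snd (snd t)"] by (simp, metis)
  qed
  ultimately show ?thesis using strong_completion completes_top_down by simp
qed

subsection \<open>Bit sets\<close>

lemma bit_less: "bit x i \<Longrightarrow> i < s" if "x < 2 ^ s" for x :: nat
  using that less_power2_iff by blast

lemma ex_nat_bits:
  fixes P :: "nat \<Rightarrow> bool"
  obtains y :: nat where "y < 2 ^ s" "\<And>i. bit y i \<longleftrightarrow> i < s \<and> P i"
proof -
  define y :: nat where "y = horner_sum of_bool 2 (map P [0..<s])"
  have bits: "bit y i \<longleftrightarrow> i < s \<and> P i" for i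
    by (auto simp: y_def bit_horner_sum_bit_iff)
  then have "y < 2 ^ s" by (simp add: less_power2_iff)
  then show thesis using bits by (rule that)
qed

lemma bits_subset_le: "x \<le> y" if "\<forall>i. bit x i \<longrightarrow> bit y i" for x y :: nat
proof -
  have "and x y = x" using that by (auto simp: bit_eq_iff bit_and_iff)
  moreover have "int (and x y) \<le> int y" by (simp add: of_nat_and_eq)
  ultimately show ?thesis by simp
qed

text \<open>The quotients by \<open>2 ^ j\<close> already differ. The cutoff \<open>j\<close> allows
  a column to lose elements below it and still grow as a number.\<close>

lemma bits_less:
  fixes x y :: nat
  assumes "\<And>i. \<lbrakk>j \<le> i; bit x i\<rbrakk> \<Longrightarrow> bit y i" and "j \<le> k" "bit y k" "\<not> bit x k"
  shows "x < y"
proof -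
  have bits: "bit (drop_bit j x) i \<longleftrightarrow> bit x (j + i)" "bit (drop_bit j y) i \<longleftrightarrow> bit y (j + i)" for i
    by (simp_all add: bit_drop_bit_eq)
  have "drop_bit j x \<le> drop_bit j y"
    by (rule bits_subset_le) (simp add: bits assms(1))
  moreover have "drop_bit j x \<noteq> drop_bit j y"
    using bits[of "k - j"] assms(2-4) by auto
  ultimately have "x div 2 ^ j < y div 2 ^ j" by (simp add: drop_bit_eq_div)
  then show ?thesis by (meson div_le_mono leD leI)
qed

definition covers :: "nat \<Rightarrow> nat \<Rightarrow> nat \<Rightarrow> bool" where
  "covers s v y \<longleftrightarrow> (\<forall>i<s. bit v i \<or> bit y i)"

text \<open>The least index outside \<open>q\<close> is used because a column can give it up in
  exchange for any other index outside \<open>q\<close> and still increase. No column qualifies if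
  \<open>q\<close> contains all indices below \<open>s\<close>.\<close>

definition misses_lowest :: "nat \<Rightarrow> nat \<Rightarrow> nat \<Rightarrow> bool" where
  "misses_lowest s q y \<longleftrightarrow> (\<exists>m<s. \<not> bit q m \<and> (\<forall>i<m. bit q i) \<and> \<not> bit y m)"

text \<open>Outside \<open>v\<close> both columns contain every index below \<open>s\<close> and
  none from \<open>s\<close> on. Hence the partner row of two usual holes is contained in
  \<open>v\<close>.\<close>

lemma covers_bit_eq:
  assumes "covers s v y" "covers s v y'" "y < 2 ^ s" "y' < 2 ^ s" "\<not> bit v i"
  shows "bit y i = bit y' i"
  using assms(1,2,5) bit_less[OF assms(3), of i] bit_less[OF assms(4), of i]
  by (auto simp: covers_def)

text \<open>The standard intercalate: \<open>y'\<close> is \<open>y\<close> joined with the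
  complement of \<open>v\<close>, and the partner is \<open>v\<close> joined with the complement of
  \<open>y\<close>. The three other cells then satisfy \<open>covers\<close>.\<close>

lemma covers_intercalate:
  assumes v: "v < 2 ^ s" and y: "y < 2 ^ s" and "\<not> covers s v y"
  obtains y' where "y' < 2 ^ s" "y < y'" "\<And>i. bit y' i \<longleftrightarrow> i < s \<and> (bit y i \<or> \<not> bit v i)"
    "\<And>i. bit (xor v (xor y y')) i \<longleftrightarrow> i < s \<and> (bit v i \<or> \<not> bit y i)"
proof -
  obtain y' :: nat where y': "y' < 2 ^ s" "\<And>i. bit y' i \<longleftrightarrow> i < s \<and> (bit y i \<or> \<not> bit v i)"
    using ex_nat_bits[of s "\<lambda>i. (bit y i \<or> \<not> bit v i)"] by blast
  note b = v[unfolded less_power2_iff] y[unfolded less_power2_iff]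
  obtain k where "k < s" "\<not> bit v k" "\<not> bit y k" using assms(3) by (auto simp: covers_def)
  then have less: "y < y'" using b by (intro bits_less[of 0 y y' k]) (auto simp: y')
  have r: "bit (xor v (xor y y')) i \<longleftrightarrow> i < s \<and> (bit v i \<or> \<not> bit y i)" for i
    using b by (auto simp: bit_xor_iff y')
  show thesis by (rule that[OF y'(1) less y'(2) r])
qed

text \<open>The least index \<open>m\<close> outside \<open>q\<close> lies in \<open>y\<close>,
  while some \<open>k\<close> outside \<open>q\<close> does not, so \<open>m < k\<close>. Giving up
  \<open>m\<close> while gaining \<open>k\<close> still increases the column, and it puts
  \<open>m\<close> into the partner, which therefore is not contained in \<open>q\<close>.\<close>

lemma lowest_missing_intercalate:
  assumes v: "v < 2 ^ s" "\<forall>i. bit v i \<longrightarrow> bit q i" and y: "y < 2 ^ s"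
    and "\<not> covers s q y" "\<not> misses_lowest s q y"
  obtains m y' where "m < s" "\<not> bit q m" "\<forall>i<m. bit q i" "bit y m" "y' < 2 ^ s" "y < y'"
    "\<And>i. bit y' i \<longleftrightarrow> i < s \<and> (bit y i \<or> \<not> bit v i) \<and> i \<noteq> m"
    "\<And>i. bit (xor v (xor y y')) i \<longleftrightarrow> i < s \<and> (bit v i \<or> \<not> bit y i \<or> i = m)"
proof -
  obtain k where k: "k < s" "\<not> bit q k" "\<not> bit y k" using assms(4) by (auto simp: covers_def)
  then obtain m where m: "\<not> bit q m" "\<forall>i<m. bit q i"
    using exists_least_iff[of "\<lambda>i. \<not> bit q i"] by blast
  then have "m \<le> k" using k by (meson leI)
  then have "m < s" using k by simp
  then have "bit y m" using assms(5) m unfolding misses_lowest_def by blast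
  then have "m < k" using k \<open>m \<le> k\<close> by (metis le_neq_implies_less)
  have "\<not> bit v m" "\<not> bit v k" using v(2) m k by auto
  obtain y' :: nat where y': "y' < 2 ^ s" "\<And>i. bit y' i \<longleftrightarrow> i < s \<and> (bit y i \<or> \<not> bit v i) \<and> i \<noteq> m"
    using ex_nat_bits[of s "\<lambda>i. (bit y i \<or> \<not> bit v i) \<and> i \<noteq> m"] by blast
  have less: "y < y'"
    using bit_less[OF y] k \<open>m < k\<close> \<open>\<not> bit v k\<close>
    by (intro bits_less[of "Suc m" y y' k]) (auto simp: y')
  have r: "bit (xor v (xor y y')) i \<longleftrightarrow> i < s \<and> (bit v i \<or> \<not> bit y i \<or> i = m)" for i
    using bit_less[OF v(1), of i] bit_less[OF y, of i] \<open>m < s\<close> \<open>\<not> bit v m\<close> \<open>bit y m\<close>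
    by (auto simp: bit_xor_iff y')
  show thesis by (rule that[OF \<open>m < s\<close> m \<open>bit y m\<close> y'(1) less y'(2) r])
qed

lemma misses_lowest_bit:
  "\<not> bit y m" if "misses_lowest s q y" "\<not> bit q m" "\<forall>i<m. bit q i"
  using that unfolding misses_lowest_def by (metis linorder_neqE_nat)

subsection \<open>Orders that place \<open>p \<union> {b}\<close> before \<open>p\<close>\<close>

text \<open>
  The bits of a number are read as a set; \<open>a\<close> gives the positions of the rows. The position order
  extends inclusion except that \<open>q = p \<union> {b}\<close>, and possibly \<open>q\<^sub>2 = p \<union> {c}\<close>, precedes \<open>p\<close>.
\<close>

locale inverted_bit =
  fixes s b c p q q\<^sub>2 :: nat and a :: "nat \<Rightarrow> nat"
  assumes b_less: "b < c" "c < s" and less: "p < 2 ^ s" "q < 2 ^ s" "q\<^sub>2 < 2 ^ s"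
    and p_b: "\<not> bit p b"
    and bit_q: "\<And>i. bit q i \<longleftrightarrow> i = b \<or> bit p i"
    and bit_q2: "\<And>i. bit q\<^sub>2 i \<longleftrightarrow> i = c \<or> bit p i"
    and before: "\<And>v w. \<lbrakk>v < 2 ^ s; w < 2 ^ s; \<forall>i. bit v i \<longrightarrow> bit w i; v \<noteq> w;
      \<not> (v = p \<and> (w = q \<or> w = q\<^sub>2))\<rbrakk> \<Longrightarrow> a v < a w"
    and inverted: "\<And>v w. \<lbrakk>v < 2 ^ s; w < 2 ^ s; \<forall>i. bit w i \<longrightarrow> bit v i; a v < a w\<rbrakk> \<Longrightarrow>
      w = p \<and> (v = q \<or> v = q\<^sub>2)"
    and q_before_p: "a q < a p"
    and before_p: "\<And>v. \<lbrakk>v < 2 ^ s; \<forall>i. bit v i \<longrightarrow> bit q i; bit v b; v \<noteq> q\<rbrakk> \<Longrightarrow> a v < a p"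
begin

text \<open>
  Since \<open>p\<close> comes after \<open>q\<close>, row \<open>p\<close> loses the intercalates with row \<open>q\<close> and keeps the additional
  holes of \<open>covers s q\<close>; these cost row \<open>q\<close> the usual holes without \<open>b\<close>, which in turn gives every
  row \<open>v \<subseteq> p\<close> the extra holes \<open>y\<close> that agree with the complement of \<open>q\<close> outside \<open>v\<close>. Among the other
  columns without \<open>b\<close>, scanning from the right selects in row \<open>q\<close> those that miss the lowest element of
  the complement of \<open>q\<close>.
\<close>

definition hole :: "nat \<Rightarrow> nat \<Rightarrow> bool" where
  "hole v y \<longleftrightarrow> (if v = q then covers s p y \<or> \<not> bit y b \<and> misses_lowest s q y
     else covers s v y \<or> (\<forall>i. bit v i \<longrightarrow> bit p i) \<and> (\<forall>i<s. \<not> bit v i \<longrightarrow> (bit y i \<longleftrightarrow> \<not> bit q i)))"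

definition rank :: "nat \<Rightarrow> nat \<Rightarrow> nat" where
  "rank v y = (if v = q then of_bool (covers s p y)
     else if \<forall>i. bit v i \<longrightarrow> bit p i then 2 * card {i. bit v i \<and> bit y i} + of_bool (covers s v y)
     else of_bool (bit y c))"

lemma p_neq_q: "p \<noteq> q"
  using bit_q p_b by auto

lemma hole_covers: "v \<noteq> q \<Longrightarrow> covers s v y \<Longrightarrow> hole v y"
  by (simp add: hole_def)

text \<open>Outside \<open>p\<close> lie \<open>b\<close> and the complement of \<open>q\<close>.
  Usual holes contain both, the extra ones lack just \<open>b\<close>.\<close>

lemma hole_p: "hole p y \<longleftrightarrow> covers s q y"
  using p_neq_q bit_q by (auto simp: hole_def covers_def)

lemma hole_intercalate_q:
  assumes y: "y < 2 ^ s" and n: "\<not> hole q y"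
  shows "\<exists>y'<2 ^ s. y < y' \<and> hole q y' \<and>
    a q < a (xor q (xor y y')) \<and> hole (xor q (xor y y')) y \<and> hole (xor q (xor y y')) y'"
proof -
  have n': "\<not> covers s p y" "bit y b \<or> \<not> misses_lowest s q y" using n by (auto simp: hole_def)
  have bs: "b < s" using b_less by simp
  note lt = less[unfolded less_power2_iff] y[unfolded less_power2_iff]
  consider "covers s q y" | "\<not> covers s q y" "bit y b" | "\<not> covers s q y" "\<not> bit y b" by blast
  then show ?thesis
  proof cases
    case 1
    then have yb: "\<not> bit y b" using n'(1) bit_q by (auto simp: covers_def)
    \<comment> \<open>Adding \<open>b\<close> alone makes \<open>p\<close> the partner, which is
      available because it comes after \<open>q\<close>.\<close>
    obtain y' :: nat where y': "y' < 2 ^ s" "\<And>i. bit y' i \<longleftrightarrow> i < s \<and> (bit y i \<or> i = b)"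
      using ex_nat_bits[of s "\<lambda>i. (bit y i \<or> i = b)"] by blast
    have "y < y'" using lt yb bs by (intro bits_less[of 0 y y' b]) (auto simp: y')
    moreover have "xor q (xor y y') = p"
    proof (rule bit_eqI)
      fix i
      show "bit (xor q (xor y y')) i \<longleftrightarrow> bit p i"
        using bit_less[OF y, of i] bs yb p_b by (cases "i = b") (auto simp: bit_xor_iff y' bit_q)
    qed
    moreover have "hole p y" "hole p y'" using 1 by (auto simp: hole_p covers_def y')
    moreover have "hole q y'" using 1 by (auto simp: hole_def covers_def y' bit_q)
    ultimately show ?thesis using y'(1) q_before_p by (intro exI[of _ y']) simp
  next
    case 2
    obtain y' where y': "y' < 2 ^ s" "y < y'" "\<And>i. bit y' i \<longleftrightarrow> i < s \<and> (bit y i \<or> \<not> bit q i)"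
      and r: "\<And>i. bit (xor q (xor y y')) i \<longleftrightarrow> i < s \<and> (bit q i \<or> \<not> bit y i)"
      using covers_intercalate[OF less(2) y 2(1)] by blast
    let ?r = "xor q (xor y y')"
    have rlt: "?r < 2 ^ s" using less(2) y y'(1) by (simp add: xor_less_power2)
    have rq: "q \<noteq> ?r" using 2(1) r unfolding covers_def by metis
    moreover have "a q < a ?r"
      by (rule before[OF less(2) rlt _ rq]) (use r lt(2) p_neq_q in auto)
    moreover have "covers s ?r y" "covers s ?r y'" by (auto simp: covers_def r y')
    moreover have "hole q y'" using 2(2) by (auto simp: hole_def covers_def y' bit_q)
    ultimately show ?thesis
      using y'(1,2) hole_covers[OF rq[symmetric]] by (intro exI[of _ y'] conjI) simp_all
  next
    case 3
    then have nl: "\<not> misses_lowest s q y" using n' by (auto simp: hole_def)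
    obtain m y' where m: "m < s" "\<not> bit q m" "\<forall>i<m. bit q i" "bit y m" and y': "y' < 2 ^ s" "y < y'"
      "\<And>i. bit y' i \<longleftrightarrow> i < s \<and> (bit y i \<or> \<not> bit q i) \<and> i \<noteq> m"
      and r: "\<And>i. bit (xor q (xor y y')) i \<longleftrightarrow> i < s \<and> (bit q i \<or> \<not> bit y i \<or> i = m)"
      using lowest_missing_intercalate[OF less(2) _ y 3(1) nl] by metis
    let ?r = "xor q (xor y y')"
    have rlt: "?r < 2 ^ s" using less(2) y y'(1) by (simp add: xor_less_power2)
    have rq: "q \<noteq> ?r" using r m by metis
    moreover have "a q < a ?r"
      by (rule before[OF less(2) rlt _ rq]) (use r lt(2) p_neq_q in auto)
    moreover have "covers s ?r y" "covers s ?r y'" by (auto simp: covers_def r y')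
    moreover have "misses_lowest s q y'" using m y' unfolding misses_lowest_def by blast
    then have "hole q y'" using 3(2) by (simp add: hole_def y' bit_q)
    ultimately show ?thesis
      using y'(1,2) hole_covers[OF rq[symmetric]] by (intro exI[of _ y'] conjI) simp_all
  qed
qed

text \<open>The standard partner can fail only if it is \<open>q\<close>, whose holes are irregular,
  or if \<open>v = p\<close> and it is \<open>q\<^sub>2\<close>, which may precede \<open>p\<close>.
  When it is \<open>q\<close> and \<open>b\<close> is not in \<open>v\<close>, the column is one of
  the extra holes.\<close>

lemma hole_intercalate:
  assumes v: "v < 2 ^ s" and y: "y < 2 ^ s" and n: "\<not> hole v y"
  shows "\<exists>y'<2 ^ s. y < y' \<and> hole v y' \<and>
    a v < a (xor v (xor y y')) \<and> hole (xor v (xor y y')) y \<and> hole (xor v (xor y y')) y'"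
proof (cases "v = q")
  case True
  then show ?thesis using hole_intercalate_q y n by blast
next
  case vq: False
  have bs: "b < s" using b_less by simp
  note lt = less[unfolded less_power2_iff] v[unfolded less_power2_iff] y[unfolded less_power2_iff]
  have nc: "\<not> covers s v y" using n vq hole_covers by blast
  obtain y' where y': "y' < 2 ^ s" "y < y'" "\<And>i. bit y' i \<longleftrightarrow> i < s \<and> (bit y i \<or> \<not> bit v i)"
    and r: "\<And>i. bit (xor v (xor y y')) i \<longleftrightarrow> i < s \<and> (bit v i \<or> \<not> bit y i)"
    using covers_intercalate[OF v y nc] by blast
  let ?r = "xor v (xor y y')"
  have rlt: "?r < 2 ^ s" using v y y'(1) by (simp add: xor_less_power2)
  have rv: "v \<noteq> ?r" using nc r unfolding covers_def by metis
  have vr: "\<forall>i. bit v i \<longrightarrow> bit ?r i" using r lt by blast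
  have cov: "covers s ?r y" "covers s ?r y'" "covers s v y'" by (auto simp: covers_def r y')
  consider "?r \<noteq> q" "\<not> (v = p \<and> ?r = q\<^sub>2)" | "?r = q" "bit v b" "bit y b" | "?r = q" "bit v b" "\<not> bit y b"
    | "?r = q" "\<not> bit v b" | "v = p" "?r = q\<^sub>2" by blast
  then show ?thesis
  proof cases
    case 1
    then have "a v < a ?r" by (intro before[OF v rlt vr rv]) blast
    then show ?thesis
      using y'(1,2) cov hole_covers[OF 1(1)] hole_covers[OF vq]
      by (intro exI[of _ y'] conjI) simp_all
  next
    case 2
    have "bit p i \<or> bit y i" if "i < s" for i
      using r[of i] 2 bit_q[of i] that by (cases "i = b") auto
    then have "covers s p y" "covers s p y'" by (auto simp: covers_def y')
    then have "hole q y" "hole q y'" by (simp_all add: hole_def)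
    moreover have "v \<noteq> p" using 2 p_b by auto
    then have "a v < a q" using before[OF v less(2)] vr vq 2 by simp
    ultimately show ?thesis
      using y'(1,2) cov hole_covers[OF vq] 2(1) by (intro exI[of _ y'] conjI) simp_all
  next
    case 3
    have rq: "bit q i \<longleftrightarrow> i < s \<and> (bit v i \<or> \<not> bit y i)" for i using r[of i] 3(1) by simp
    \<comment> \<open>Adding \<open>b\<close> to the standard column moves the partner from
      \<open>q\<close> to \<open>p\<close>, whose holes are all columns covering
      \<open>q\<close>.\<close>
    obtain z :: nat where z: "z < 2 ^ s" "\<And>i. bit z i \<longleftrightarrow> i < s \<and> (bit y i \<or> \<not> bit v i \<or> i = b)"
      using ex_nat_bits[of s "\<lambda>i. (bit y i \<or> \<not> bit v i \<or> i = b)"] by blast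
    have "y < z" using lt 3 bs by (intro bits_less[of 0 y z b]) (auto simp: z)
    moreover have "covers s v z" by (auto simp: covers_def z)
    moreover have xz: "xor v (xor y z) = p"
    proof (rule bit_eqI)
      fix i
      show "bit (xor v (xor y z)) i = bit p i"
        using rq[of i] bit_q[of i] bit_less[OF v, of i] bit_less[OF y, of i] 3 p_b
        by (cases "i = b") (auto simp: bit_xor_iff z)
    qed
    moreover have "a v < a p" using before_p[OF v] vr 3 vq by simp
    moreover have "covers s q y" "covers s q z" using rq by (auto simp: covers_def z)
    ultimately show ?thesis
      using z(1) hole_covers[OF vq] by (intro exI[of _ z] conjI) (simp_all add: hole_p)
  next
    case 4
    have rq: "bit q i \<longleftrightarrow> i < s \<and> (bit v i \<or> \<not> bit y i)" for i using r[of i] 4(1) by simp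
    have "\<forall>i. bit v i \<longrightarrow> bit p i" using rq bit_q 4(2) bit_less[OF v] by metis
    moreover have "\<forall>i<s. \<not> bit v i \<longrightarrow> (bit y i \<longleftrightarrow> \<not> bit q i)" using rq by metis
    ultimately have "hole v y" using vq by (simp add: hole_def)
    then show ?thesis using n by simp
  next
    case 5
    have rq: "bit q\<^sub>2 i \<longleftrightarrow> i < s \<and> (bit p i \<or> \<not> bit y i)" for i using r[of i] 5 by simp
    have pc: "\<not> bit p c" using rv 5 bit_q2 by (metis bit_eqI)
    have yc: "\<not> bit y c" using rq[of c] bit_q2 pc by auto
    \<comment> \<open>The substitute partner is \<open>p\<close> with both \<open>b\<close> and
      \<open>c\<close> added: the column gains \<open>c\<close> and gives up \<open>b\<close>, and
      still grows since \<open>b < c\<close>.\<close>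
    obtain z :: nat where z: "z < 2 ^ s" "\<And>i. bit z i \<longleftrightarrow> i < s \<and> (bit y i \<or> i = c) \<and> i \<noteq> b"
      using ex_nat_bits[of s "\<lambda>i. (bit y i \<or> i = c) \<and> i \<noteq> b"] by blast
    have yb: "bit y b" using rq[of b] bit_q2[of b] p_b b_less by auto
    have "y < z" using lt yc b_less by (intro bits_less[of "Suc b" y z c]) (auto simp: z)
    moreover have w: "bit (xor v (xor y z)) i \<longleftrightarrow> i = b \<or> i = c \<or> bit p i" for i
      using 5(1) bit_less[OF v, of i] bit_less[OF y, of i] b_less yc yb pc p_b
      by (cases "i = b"; cases "i = c") (auto simp: bit_xor_iff z)
    let ?w = "xor v (xor y z)"
    have "?w < 2 ^ s" using v y z(1) by (simp add: xor_less_power2)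
    moreover have wq: "?w \<noteq> q" "?w \<noteq> q\<^sub>2" "?w \<noteq> p"
      using w[of c] w[of b] bit_q[of c] bit_q2[of b] pc p_b b_less by auto
    ultimately have "a v < a ?w" using w 5(1) by (intro before[OF v]) auto
    moreover have y1: "bit y i" if "\<not> bit p i" "i < s" "i \<noteq> c" for i
      using rq[of i] bit_q2[of i] that by auto
    have "covers s q z" using y1 by (auto simp: covers_def z bit_q)
    then have "hole v z" using hole_p 5(1) by simp
    moreover have "covers s ?w y" "covers s ?w z" using y1 by (auto simp: covers_def z w)
    ultimately show ?thesis
      using z(1) \<open>y < z\<close> hole_covers[OF wq(1)] by (intro exI[of _ z] conjI) simp_all
  qed
qed

text \<open>If \<open>y\<close> and \<open>y'\<close> agree outside \<open>v\<close>, then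
  \<open>r\<close> is contained in \<open>v\<close> and comes after it, which happens only for
  inverted pairs. Inside \<open>p\<close> this leaves only pairs with exactly one usual
  hole.\<close>

lemma hole_rank:
  assumes v: "v < 2 ^ s" and y: "y < 2 ^ s" "y' < 2 ^ s" and h: "hole v y" "hole v y'"
    and r: "r = xor v (xor y y')" and ord: "a v < a r" and hr: "hole r y"
  shows "rank v y' < rank v y"
proof -
  have bs: "b < s" using b_less by simp
  have rlt: "r < 2 ^ s" using v y by (simp add: r xor_less_power2)
  have rv: "r \<noteq> v" using ord by auto
  have br: "bit r i \<longleftrightarrow> (bit v i \<noteq> (bit y i \<noteq> bit y' i))" for i by (simp add: r bit_xor_iff)
  note lt = less[unfolded less_power2_iff] v[unfolded less_power2_iff] y[unfolded less_power2_iff]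
  have sub: "r = p \<and> (v = q \<or> v = q\<^sub>2)" if "\<And>i. \<not> bit v i \<Longrightarrow> bit y i = bit y' i"
    by (rule inverted[OF v rlt _ ord]) (use that br in blast)
  consider "v = q" | "v \<noteq> q" "\<forall>i. bit v i \<longrightarrow> bit p i" | "v \<noteq> q" "\<not> (\<forall>i. bit v i \<longrightarrow> bit p i)"
    by blast
  then show ?thesis
  proof cases
    case 1
    have "covers s p y"
    proof (rule ccontr)
      assume "\<not> covers s p y"
      then have yb: "\<not> bit y b" and "misses_lowest s q y" using h(1) 1 by (auto simp: hole_def)
      then obtain m where m: "m < s" "\<not> bit q m" "\<forall>i<m. bit q i" "\<not> bit y m"
        by (auto simp: misses_lowest_def)
      have pm: "\<not> bit p m" "m \<noteq> b" using m(2) bit_q by auto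
      show False
      proof (cases "bit y' b")
        case True
        then have "covers s p y'" using h(2) 1 by (auto simp: hole_def)
        then have "bit y' m" using pm m by (auto simp: covers_def)
        then have "\<not> bit r b" "bit r m" using br 1 yb True m bit_q by auto
        then show False using hr yb m pm rv 1 bs by (auto simp: hole_def covers_def)
      next
        case False
        then have "misses_lowest s q y'" using h(2) 1 p_b bs by (auto simp: hole_def covers_def)
        then have "\<not> bit y' m" using m misses_lowest_bit by blast
        then have "bit r b" "\<not> bit r m" using br 1 yb False m bit_q by auto
        then show False using hr yb m pm rv 1 p_b by (auto simp: hole_def covers_def)
      qed
    qed
    moreover have "\<not> covers s p y'"
    proof
      assume c': "covers s p y'"
      have "bit y i = bit y' i" if "\<not> bit q i" for i
        using covers_bit_eq[OF \<open>covers s p y\<close> c' y] that bit_q by simp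
      then have "r = p" using sub 1 by blast
      moreover have "bit r b" using br[of b] c' \<open>covers s p y\<close> bs p_b 1 bit_q by (auto simp: covers_def)
      ultimately show False using p_b by simp
    qed
    ultimately show ?thesis using 1 by (simp add: rank_def)
  next
    case 2
    have vb: "\<not> bit v b" using 2 p_b by blast
    have neq: "covers s v y \<noteq> covers s v y'"
    proof
      assume eq: "covers s v y = covers s v y'"
      have "bit y i = bit y' i" if "\<not> bit v i" for i
      proof (cases "covers s v y")
        case True
        then show ?thesis using covers_bit_eq[OF _ _ y] eq that by simp
      next
        case False
        then have "i < s \<Longrightarrow> bit y i = bit y' i" using h eq 2 that by (simp add: hole_def)
        then show ?thesis using bit_less[OF y(1), of i] bit_less[OF y(2), of i] by blast
      qed
      then have "r = p" "v = q\<^sub>2" using sub 2 by blast+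
      then show False using rv 2 bit_q2 by (metis bit_eqI)
    qed
    \<comment> \<open>Outside \<open>v\<close> one column contains every index below
      \<open>s\<close>, the other just the complement of \<open>q\<close>.\<close>
    have out: "bit r i \<longleftrightarrow> bit q i" if "\<not> bit v i" for i
    proof (cases "i < s")
      case True
      show ?thesis
      proof (cases "covers s v y")
        case c: True
        then have "bit y i" "bit y' i \<longleftrightarrow> \<not> bit q i"
          using h neq 2 that True by (auto simp: hole_def covers_def)
        then show ?thesis using br[of i] that by simp
      next
        case c: False
        then have "bit y' i" "bit y i \<longleftrightarrow> \<not> bit q i"
          using h neq 2 that True by (auto simp: hole_def covers_def)
        then show ?thesis using br[of i] that by simp
      qed
    next
      case False
      then show ?thesis using bit_less[OF rlt, of i] bit_less[OF less(2), of i] by blast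
    qed
    have "bit r b" using out vb bit_q by blast
    then have cr: "covers s r y" if "r \<noteq> q" using hr that p_b by (auto simp: hole_def)
    let ?A = "\<lambda>y. {i. bit v i \<and> bit y i}"
    have fin: "finite (?A y)" by (rule finite_subset[of _ "{..<s}"]) (use lt in auto)
    have le: "?A y' \<subseteq> ?A y"
    proof (cases "r = q")
      case True
      have "bit y i" if "bit v i" "bit y' i" for i
        using that br[of i] bit_q[of i] 2(2) True by auto
      then show ?thesis by blast
    next
      case False
      have "bit y i" if "bit v i" "bit y' i" for i
        using that br[of i] cr[OF False] bit_less[OF v, of i] by (auto simp: covers_def)
      then show ?thesis by blast
    qed
    show ?thesis
    proof (cases "covers s v y")
      case True
      then show ?thesis
        using neq 2 card_mono[OF fin le] by (simp add: rank_def)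
    next
      case False
      then have Y: "bit y i \<longleftrightarrow> \<not> bit q i" if "i < s" "\<not> bit v i" for i
        using h(1) 2 that by (auto simp: hole_def)
      \<comment> \<open>Here \<open>y\<close> lacks \<open>b\<close> but contains the complement of
        \<open>q\<close>, so it is no hole of row \<open>q\<close>. Hence \<open>r\<close> lacks an
        element of \<open>v\<close>, and the trace drops strictly.\<close>
      have "r \<noteq> q"
      proof
        assume "r = q"
        have "\<not> bit y b" using Y[OF bs vb] bit_q by simp
        then have "misses_lowest s q y" using hr \<open>r = q\<close> p_b bs by (auto simp: hole_def covers_def)
        then obtain m where "m < s" "\<not> bit q m" "\<not> bit y m" by (auto simp: misses_lowest_def)
        then show False using Y[of m] 2 bit_q by blast
      qed
      then obtain i where i: "bit r i \<noteq> bit q i" by (auto simp: bit_eq_iff)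
      then have "bit v i" using out by blast
      then have "\<not> bit r i" using i 2 bit_q by blast
      then have "bit y i \<noteq> bit y' i" using br[of i] \<open>bit v i\<close> by blast
      then have "?A y' \<subset> ?A y" using le \<open>bit v i\<close> by blast
      then have "card (?A y') < card (?A y)" using fin by (rule psubset_card_mono[rotated])
      then show ?thesis using 2 by (simp add: rank_def)
    qed
  next
    case 3
    then have "covers s v y" "covers s v y'" using h by (auto simp: hole_def)
    then have "bit y i = bit y' i" if "\<not> bit v i" for i
      using covers_bit_eq[OF _ _ y] that by simp
    then have rp: "r = p" "v = q\<^sub>2" using sub 3 by blast+
    then have pc: "\<not> bit p c" using rv bit_q2 by (metis bit_eqI)
    have "\<not> bit q c" using pc b_less by (simp add: bit_q)
    moreover have "covers s q y" using hr hole_p rp by simp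
    ultimately have "bit y c" using b_less by (auto simp: covers_def)
    moreover have "\<not> bit y' c" using br[of c] rp pc bit_q2 \<open>bit y c\<close> by auto
    moreover have "rank v z = of_bool (bit z c)" for z using 3 unfolding rank_def by meson
    ultimately show ?thesis by simp
  qed
qed

end

subsection \<open>Orders that place \<open>j \<union> {b, c}\<close> before \<open>j \<union> {c}\<close> before \<open>j \<union> {b}\<close>\<close>

text \<open>By \<open>low\<close>, \<open>b\<close> and \<open>c\<close> are the two least indices,
  so any other index gained by a column outweighs the loss of \<open>c\<close>.
  \<open>before_j\<close> makes \<open>j\<close> a substitute partner where \<open>p\<^sub>2\<close>
  is unusable.\<close>

locale inverted_two_bits =
  fixes s b c j p\<^sub>1 p\<^sub>2 q :: nat and a :: "nat \<Rightarrow> nat"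
  assumes b_less: "b < c" "c < s" and low: "\<And>i. i = b \<or> i = c \<or> c < i"
    and less: "j < 2 ^ s" "p\<^sub>1 < 2 ^ s" "p\<^sub>2 < 2 ^ s" "q < 2 ^ s"
    and j_low: "\<not> bit j b" "\<not> bit j c"
    and bit_p1: "\<And>i. bit p\<^sub>1 i \<longleftrightarrow> i = b \<or> bit j i"
    and bit_p2: "\<And>i. bit p\<^sub>2 i \<longleftrightarrow> i = c \<or> bit j i"
    and bit_q: "\<And>i. bit q i \<longleftrightarrow> i = b \<or> i = c \<or> bit j i"
    and before: "\<And>v w. \<lbrakk>v < 2 ^ s; w < 2 ^ s; \<forall>i. bit v i \<longrightarrow> bit w i; v \<noteq> w;
      \<not> (w = q \<and> (v = p\<^sub>1 \<or> v = p\<^sub>2))\<rbrakk> \<Longrightarrow> a v < a w"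
    and inverted: "\<And>v w. \<lbrakk>v < 2 ^ s; w < 2 ^ s; \<forall>i. bit w i \<longrightarrow> bit v i; a v < a w\<rbrakk> \<Longrightarrow>
      v = q \<and> (w = p\<^sub>1 \<or> w = p\<^sub>2)"
    and q_before: "a q < a p\<^sub>2" "a p\<^sub>2 < a p\<^sub>1"
    and before_j: "\<And>v. \<lbrakk>v < 2 ^ s; \<forall>i. bit v i \<longrightarrow> bit p\<^sub>2 i; bit v c; v \<noteq> p\<^sub>2\<rbrakk> \<Longrightarrow> a v < a j"
begin

text \<open>Row \<open>q\<close> now has \<open>p\<^sub>1\<close> and \<open>p\<^sub>2\<close> as
  later partners, reached by changing one of \<open>c\<close> and \<open>b\<close>; row
  \<open>p\<^sub>2\<close> has \<open>p\<^sub>1\<close>, reached by changing both. Hence the tests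
  on these two indices, with \<open>misses_lowest\<close> selecting the holes among the columns that
  fail them. The last clause says that outside \<open>v\<close> the column is the complement of
  \<open>p\<^sub>2\<close>.\<close>

definition hole :: "nat \<Rightarrow> nat \<Rightarrow> bool" where
  "hole v y \<longleftrightarrow>
    (if v = q then if bit y b = bit y c then covers s q y else misses_lowest s q y
     else if v = p\<^sub>2 then if bit y c then covers s q y else misses_lowest s q y
     else covers s v y \<or> (\<forall>i. bit v i \<longrightarrow> bit p\<^sub>1 i) \<and>
       (\<forall>i<s. \<not> bit v i \<longrightarrow> (bit y i \<longleftrightarrow> \<not> bit q i \<or> i = b)))"

text \<open>The weight 4 lets one element of the trace on \<open>v\<close> away from
  \<open>b\<close> outweigh the tie breaker. Ties arise only for the partners \<open>q\<close> and
  \<open>p\<^sub>2\<close>; if \<open>v\<close> contains \<open>b\<close>, partner \<open>q\<close>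
  leads from 3 to 0 or from 2 to 1, and partner \<open>p\<^sub>2\<close> from 3 to 2 or from 1 to
  0.\<close>

definition rank :: "nat \<Rightarrow> nat \<Rightarrow> nat" where
  "rank v y =
    (if v = q then if bit y b \<noteq> bit y c then 1 else if bit y b then 2 else 0
     else if v = p\<^sub>2 then of_bool (bit y c)
     else 4 * card {i. i \<noteq> b \<and> bit v i \<and> bit y i} +
       (if \<not> bit v b then of_bool (covers s v y)
        else if covers s v y then if bit y b then 3 else 1 else if bit y b then 0 else 2))"

lemma neqs: "p\<^sub>1 \<noteq> q" "p\<^sub>2 \<noteq> q" "p\<^sub>1 \<noteq> p\<^sub>2" "j \<noteq> q" "j \<noteq> p\<^sub>2" "j \<noteq> p\<^sub>1"
  using bit_p1[of b] bit_p2[of b] bit_q[of b] bit_p1[of c] bit_p2[of c] bit_q[of c] j_low b_less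
  by auto

lemma hole_covers: "v \<noteq> q \<Longrightarrow> v \<noteq> p\<^sub>2 \<Longrightarrow> covers s v y \<Longrightarrow> hole v y"
  by (simp add: hole_def)

lemma hole_p1: "hole p\<^sub>1 y \<longleftrightarrow> covers s q y"
proof -
  have "covers s p\<^sub>1 y \<or> (\<forall>i<s. \<not> bit p\<^sub>1 i \<longrightarrow> (bit y i \<longleftrightarrow> \<not> bit q i \<or> i = b)) \<longleftrightarrow> covers s q y"
    by (auto simp: covers_def bit_p1 bit_q)
  then show ?thesis using neqs by (simp add: hole_def)
qed

lemma hole_p2: "hole p\<^sub>2 y \<longleftrightarrow> (if bit y c then covers s q y else misses_lowest s q y)"
  using neqs by (simp add: hole_def)

lemma p2_subset_q: "\<forall>i. bit p\<^sub>2 i \<longrightarrow> bit q i"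
  by (simp add: bit_p2 bit_q)

lemma covers_p2: "covers s p\<^sub>2 y \<Longrightarrow> covers s q y"
  using p2_subset_q by (auto simp: covers_def)

text \<open>A row with an index outside \<open>q\<close> is neither \<open>q\<close> nor
  \<open>p\<^sub>2\<close> nor contained in \<open>p\<^sub>1\<close>.\<close>

lemma hole_iff_covers: "bit v m \<Longrightarrow> \<not> bit q m \<Longrightarrow> hole v y \<longleftrightarrow> covers s v y"
  using p2_subset_q bit_p1 bit_q by (auto simp: hole_def)

text \<open>The partner contains an index outside \<open>q\<close>, so it comes after
  \<open>v\<close> and has only usual holes. The new column changes no index of \<open>v\<close>, so
  it falls under the same test on \<open>b\<close> and \<open>c\<close> as \<open>y\<close>.\<close>

lemma hole_intercalate_lowest:
  assumes v: "v = q \<and> bit y b \<noteq> bit y c \<or> v = p\<^sub>2 \<and> \<not> bit y c"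
    and y: "y < 2 ^ s" and nc: "\<not> covers s q y" and nl: "\<not> misses_lowest s q y"
  shows "\<exists>y'<2 ^ s. y < y' \<and> hole v y' \<and>
    a v < a (xor v (xor y y')) \<and> hole (xor v (xor y y')) y \<and> hole (xor v (xor y y')) y'"
proof -
  have vlt: "v < 2 ^ s" using v less by auto
  have vq: "\<forall>i. bit v i \<longrightarrow> bit q i" using v p2_subset_q by auto
  obtain m y' where m: "m < s" "\<not> bit q m" "\<forall>i<m. bit q i" "bit y m" and y': "y' < 2 ^ s" "y < y'"
    "\<And>i. bit y' i \<longleftrightarrow> i < s \<and> (bit y i \<or> \<not> bit v i) \<and> i \<noteq> m"
    and r: "\<And>i. bit (xor v (xor y y')) i \<longleftrightarrow> i < s \<and> (bit v i \<or> \<not> bit y i \<or> i = m)"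
    using lowest_missing_intercalate[OF vlt vq y nc nl] by metis
  let ?r = "xor v (xor y y')"
  have rlt: "?r < 2 ^ s" using vlt y y'(1) by (simp add: xor_less_power2)
  have rm: "bit ?r m" using r m by blast
  have "v \<noteq> ?r" using rm vq m(2) by auto
  then have "a v < a ?r"
    by (rule before[OF vlt rlt, rotated]) (use rm m(2) r bit_less[OF vlt] in auto)
  moreover have "hole ?r y" "hole ?r y'"
    unfolding hole_iff_covers[OF rm m(2)] by (auto simp: covers_def r y')
  moreover have "misses_lowest s q y'" using m y' unfolding misses_lowest_def by blast
  then have "hole v y'"
    using v m(2) bit_less[OF y] neqs(2) by (auto simp: hole_def y' bit_q bit_p2)
  ultimately show ?thesis using y'(1,2) by (intro exI[of _ y'] conjI)
qed

lemma hole_intercalate_q: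
  assumes y: "y < 2 ^ s" and n: "\<not> hole q y"
  shows "\<exists>y'<2 ^ s. y < y' \<and> hole q y' \<and>
    a q < a (xor q (xor y y')) \<and> hole (xor q (xor y y')) y \<and> hole (xor q (xor y y')) y'"
proof -
  have bs: "b < s" "c < s" using b_less by simp_all
  consider "bit y b = bit y c" "\<not> covers s q y"
    | "bit y b \<noteq> bit y c" "\<not> misses_lowest s q y" "\<not> covers s q y"
    | "bit y b \<noteq> bit y c" "covers s q y"
    using n by (auto simp: hole_def split: if_splits)
  then show ?thesis
  proof cases
    case 1
    obtain y' where y': "y' < 2 ^ s" "y < y'" "\<And>i. bit y' i \<longleftrightarrow> i < s \<and> (bit y i \<or> \<not> bit q i)"
      and r: "\<And>i. bit (xor q (xor y y')) i \<longleftrightarrow> i < s \<and> (bit q i \<or> \<not> bit y i)"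
      using covers_intercalate[OF less(4) y 1(2)] by blast
    let ?r = "xor q (xor y y')"
    have rlt: "?r < 2 ^ s" using less(4) y y'(1) by (simp add: xor_less_power2)
    obtain m where m: "bit ?r m" "\<not> bit q m" using 1(2) r by (auto simp: covers_def)
    then have "q \<noteq> ?r" by auto
    then have "a q < a ?r"
      by (rule before[OF less(4) rlt, rotated]) (use r bit_less[OF less(4)] neqs in auto)
    moreover have "hole ?r y" "hole ?r y'"
      unfolding hole_iff_covers[OF m] by (auto simp: covers_def r y')
    moreover have "bit y' b = bit y' c" "covers s q y'" using 1(1) bs by (auto simp: y' bit_q covers_def)
    then have "hole q y'" by (simp add: hole_def)
    ultimately show ?thesis using y'(1,2) by (intro exI[of _ y'] conjI)
  next
    case 2
    then show ?thesis using hole_intercalate_lowest y by blast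
  next
    case 3
    \<comment> \<open>Adding the missing one of \<open>b\<close> and \<open>c\<close> gives the
      partner \<open>p\<^sub>2\<close> or \<open>p\<^sub>1\<close>, both after
      \<open>q\<close>.\<close>
    obtain y' :: nat where y': "y' < 2 ^ s" "\<And>i. bit y' i \<longleftrightarrow> i < s \<and> (bit y i \<or> i = b \<or> i = c)"
      using ex_nat_bits[of s "\<lambda>i. bit y i \<or> i = b \<or> i = c"] by blast
    have "y < y'"
      using 3(1) bs bit_less[OF y] by (intro bits_less[of 0 y y' "if bit y b then c else b"]) (auto simp: y')
    moreover have cov: "covers s q y'" using 3(2) by (auto simp: covers_def y')
    then have "hole q y'" using bs by (simp add: hole_def y')
    moreover have r: "xor q (xor y y') = (if bit y c then p\<^sub>2 else p\<^sub>1)"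
    proof (rule bit_eqI)
      fix i
      show "bit (xor q (xor y y')) i \<longleftrightarrow> bit (if bit y c then p\<^sub>2 else p\<^sub>1) i"
        using 3(1) bs bit_less[OF y, of i] b_less j_low
        by (cases "i = b"; cases "i = c") (auto simp: bit_xor_iff y' bit_q bit_p1 bit_p2)
    qed
    moreover have "a q < a (if bit y c then p\<^sub>2 else p\<^sub>1)" using q_before by auto
    moreover have "hole (if bit y c then p\<^sub>2 else p\<^sub>1) y" "hole (if bit y c then p\<^sub>2 else p\<^sub>1) y'"
      using 3 cov bs by (auto simp: hole_p1 hole_p2 y')
    ultimately show ?thesis using y'(1) by (intro exI[of _ y'] conjI) simp_all
  qed
qed

lemma hole_intercalate_p2:
  assumes y: "y < 2 ^ s" and n: "\<not> hole p\<^sub>2 y"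
  shows "\<exists>y'<2 ^ s. y < y' \<and> hole p\<^sub>2 y' \<and>
    a p\<^sub>2 < a (xor p\<^sub>2 (xor y y')) \<and> hole (xor p\<^sub>2 (xor y y')) y \<and> hole (xor p\<^sub>2 (xor y y')) y'"
proof -
  have bs: "b < s" "c < s" using b_less by simp_all
  consider "bit y c" "\<not> covers s q y"
    | "\<not> bit y c" "\<not> misses_lowest s q y" "\<not> covers s q y"
    | "\<not> bit y c" "covers s q y"
    using n neqs(2) by (auto simp: hole_def split: if_splits)
  then show ?thesis
  proof cases
    case 1
    then have nc: "\<not> covers s p\<^sub>2 y" using covers_p2 by blast
    obtain y' where y': "y' < 2 ^ s" "y < y'" "\<And>i. bit y' i \<longleftrightarrow> i < s \<and> (bit y i \<or> \<not> bit p\<^sub>2 i)"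
      and r: "\<And>i. bit (xor p\<^sub>2 (xor y y')) i \<longleftrightarrow> i < s \<and> (bit p\<^sub>2 i \<or> \<not> bit y i)"
      using covers_intercalate[OF less(3) y nc] by blast
    let ?r = "xor p\<^sub>2 (xor y y')"
    have rlt: "?r < 2 ^ s" using less(3) y y'(1) by (simp add: xor_less_power2)
    obtain m where m: "bit ?r m" "\<not> bit q m" using 1(2) r by (auto simp: covers_def)
    then have "p\<^sub>2 \<noteq> ?r" using p2_subset_q by auto
    then have "a p\<^sub>2 < a ?r"
      by (rule before[OF less(3) rlt, rotated]) (use m r bit_less[OF less(3)] in auto)
    moreover have "hole ?r y" "hole ?r y'"
      unfolding hole_iff_covers[OF m] by (auto simp: covers_def r y')
    moreover have "bit y' c" "covers s q y'" using 1(1) bs p2_subset_q by (auto simp: y' covers_def)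
    then have "hole p\<^sub>2 y'" using neqs(2) by (simp add: hole_def)
    ultimately show ?thesis using y'(1,2) by (intro exI[of _ y'] conjI)
  next
    case 2
    then show ?thesis using hole_intercalate_lowest y by blast
  next
    case 3
    \<comment> \<open>Flipping both \<open>b\<close> and \<open>c\<close> makes
      \<open>p\<^sub>1\<close> the partner; gaining \<open>c\<close> outweighs a possible loss of
      \<open>b\<close>.\<close>
    obtain y' :: nat where y': "y' < 2 ^ s" "\<And>i. bit y' i \<longleftrightarrow> i < s \<and> (if i = b then \<not> bit y b else bit y i \<or> i = c)"
      using ex_nat_bits[of s "\<lambda>i. if i = b then \<not> bit y b else bit y i \<or> i = c"] by blast
    have "y < y'"
      using 3(1) b_less bit_less[OF y] by (intro bits_less[of c y y' c]) (auto simp: y')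
    moreover have cov: "covers s q y'" using 3(2) by (auto simp: covers_def y' bit_q)
    then have "hole p\<^sub>2 y'" using b_less neqs(2) by (simp add: hole_def y')
    moreover have r: "xor p\<^sub>2 (xor y y') = p\<^sub>1"
    proof (rule bit_eqI)
      fix i
      show "bit (xor p\<^sub>2 (xor y y')) i \<longleftrightarrow> bit p\<^sub>1 i"
        using 3(1) bs bit_less[OF y, of i] b_less j_low
        by (cases "i = b"; cases "i = c") (auto simp: bit_xor_iff y' bit_p1 bit_p2)
    qed
    moreover have "hole p\<^sub>1 y" "hole p\<^sub>1 y'" using 3 cov by (simp_all add: hole_p1)
    ultimately show ?thesis using y'(1) q_before by (intro exI[of _ y'] conjI) simp_all
  qed
qed

lemma hole_intercalate:
  assumes v: "v < 2 ^ s" and y: "y < 2 ^ s" and n: "\<not> hole v y"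
  shows "\<exists>y'<2 ^ s. y < y' \<and> hole v y' \<and>
    a v < a (xor v (xor y y')) \<and> hole (xor v (xor y y')) y \<and> hole (xor v (xor y y')) y'"
proof (cases "v = q \<or> v = p\<^sub>2")
  case True
  then show ?thesis using hole_intercalate_q hole_intercalate_p2 y n by blast
next
  case False
  then have vq: "v \<noteq> q" "v \<noteq> p\<^sub>2" by auto
  have bs: "b < s" "c < s" using b_less by simp_all
  have nc: "\<not> covers s v y" using n vq hole_covers by blast
  obtain y' where y': "y' < 2 ^ s" "y < y'" "\<And>i. bit y' i \<longleftrightarrow> i < s \<and> (bit y i \<or> \<not> bit v i)"
    and r: "\<And>i. bit (xor v (xor y y')) i \<longleftrightarrow> i < s \<and> (bit v i \<or> \<not> bit y i)"
    using covers_intercalate[OF v y nc] by blast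
  let ?r = "xor v (xor y y')"
  have rlt: "?r < 2 ^ s" using v y y'(1) by (simp add: xor_less_power2)
  have rv: "v \<noteq> ?r" using nc r unfolding covers_def by metis
  have vr: "\<forall>i. bit v i \<longrightarrow> bit ?r i" using r bit_less[OF v] by blast
  have cov: "covers s ?r y" "covers s ?r y'" "covers s v y'" by (auto simp: covers_def r y')
  have hv: "hole v y'" using cov(3) hole_covers[OF vq] by simp
  consider "?r \<noteq> q" "?r \<noteq> p\<^sub>2" | "?r = q" "bit v c" | "?r = q" "\<not> bit v c"
    | "?r = p\<^sub>2" "bit v c" | "?r = p\<^sub>2" "\<not> bit v c" by blast
  then show ?thesis
  proof cases
    case 1
    then have "a v < a ?r" by (intro before[OF v rlt vr rv]) blast
    then show ?thesis
      using y'(1,2) cov hole_covers[OF 1] hv by (intro exI[of _ y'] conjI) simp_all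
  next
    case 2
    have rq: "bit q i \<longleftrightarrow> i < s \<and> (bit v i \<or> \<not> bit y i)" for i using r[of i] 2(1) by simp
    have vsub: "bit v i \<longrightarrow> bit q i" for i using vr 2(1) by simp
    have "v \<noteq> p\<^sub>1" using 2(2) bit_p1[of c] j_low b_less by auto
    then have "a v < a q" using vsub vq by (intro before[OF v less(4)]) auto
    then have ord: "a v < a p\<^sub>1" using q_before by simp
    \<comment> \<open>Without such an index \<open>v\<close> would be \<open>q\<close> or
      \<open>p\<^sub>2\<close>. Gaining \<open>k\<close> lets the column flip \<open>c\<close>,
      which turns the partner \<open>q\<close> into \<open>p\<^sub>1\<close>.\<close>
    obtain k where k: "bit q k" "\<not> bit v k" "c < k"
    proof -
      have "\<exists>k. k \<noteq> b \<and> k \<noteq> c \<and> bit q k \<and> \<not> bit v k"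
      proof (rule ccontr)
        assume *: "\<not> ?thesis"
        have "v = (if bit v b then q else p\<^sub>2)"
        proof (rule bit_eqI)
          fix i
          show "bit v i \<longleftrightarrow> bit (if bit v b then q else p\<^sub>2) i"
            using * 2(2) vsub[of i] bit_q[of i] bit_p2[of i] j_low b_less
            by (cases "i = b"; cases "i = c") auto
        qed
        then show False using vq by (metis (full_types))
      qed
      then show thesis using that low by blast
    qed
    obtain z :: nat where z: "z < 2 ^ s"
      "\<And>i. bit z i \<longleftrightarrow> i < s \<and> (if i = c then \<not> bit y c else bit y i \<or> \<not> bit v i)"
      using ex_nat_bits[of s "\<lambda>i. if i = c then \<not> bit y c else bit y i \<or> \<not> bit v i"] by blast
    have "y < z"
      using k rq[of k] bit_less[OF y] by (intro bits_less[of "Suc c" y z k]) (auto simp: z)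
    moreover have "covers s v z" using 2(2) by (auto simp: covers_def z)
    then have "hole v z" by (rule hole_covers[OF vq])
    moreover have "xor v (xor y z) = p\<^sub>1"
    proof (rule bit_eqI)
      fix i
      show "bit (xor v (xor y z)) i \<longleftrightarrow> bit p\<^sub>1 i"
        using rq[of i] bit_q[of i] bit_p1[of i] bit_less[OF v, of i] bit_less[OF y, of i] 2(2) j_low b_less
        by (cases "i = c") (auto simp: bit_xor_iff z)
    qed
    moreover have "covers s q y" "covers s q z" using rq bit_q[of c] by (auto simp: covers_def z)
    ultimately show ?thesis
      using z(1) ord by (intro exI[of _ z] conjI) (simp_all add: hole_p1)
  next
    case 3
    have rq: "bit q i \<longleftrightarrow> i < s \<and> (bit v i \<or> \<not> bit y i)" for i using r[of i] 3(1) by simp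
    have vsub: "bit v i \<longrightarrow> bit q i" for i using vr 3(1) by simp
    show ?thesis
    proof (cases "bit v b")
      case True
      have "\<forall>i. bit v i \<longrightarrow> bit p\<^sub>1 i" using vsub 3(2) bit_q bit_p1 by metis
      moreover have "\<forall>i<s. \<not> bit v i \<longrightarrow> (bit y i \<longleftrightarrow> \<not> bit q i \<or> i = b)" using rq True by metis
      ultimately have "hole v y" using vq by (simp add: hole_def)
      then show ?thesis using n by simp
    next
      case False
      have "\<not> bit y b" "\<not> bit y c" using rq[of b] rq[of c] bit_q[of b] bit_q[of c] False 3(2) by auto
      moreover have "bit y' b" "bit y' c" using False 3(2) bs by (simp_all add: y')
      moreover have "covers s q y" "covers s q y'" using cov 3(1) by simp_all
      ultimately have "hole q y" "hole q y'" by (simp_all add: hole_def)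
      moreover have "v \<noteq> p\<^sub>1" using False bit_p1[of b] by auto
      then have "a v < a q" using vsub vq by (intro before[OF v less(4)]) auto
      ultimately show ?thesis using y'(1,2) hv 3(1) by (intro exI[of _ y'] conjI) simp_all
    qed
  next
    case 4
    have rq: "bit p\<^sub>2 i \<longleftrightarrow> i < s \<and> (bit v i \<or> \<not> bit y i)" for i using r[of i] 4(1) by simp
    have vsub: "bit v i \<longrightarrow> bit p\<^sub>2 i" for i using vr 4(1) by simp
    show ?thesis
    proof (cases "bit y c")
      case True
      have "covers s q y" "covers s q y'" using cov 4(1) covers_p2 by simp_all
      then have "hole p\<^sub>2 y" "hole p\<^sub>2 y'" using True bs neqs(2) by (simp_all add: hole_def y')
      moreover have "a v < a p\<^sub>2" using vsub vq neqs(2) by (intro before[OF v less(3)]) auto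
      ultimately show ?thesis using y'(1,2) hv 4(1) by (intro exI[of _ y'] conjI) simp_all
    next
      case False
      \<comment> \<open>Adding \<open>c\<close> to the standard column moves the partner from
        \<open>p\<^sub>2\<close> to \<open>j\<close>, where \<open>y\<close> is an extra
        hole.\<close>
      obtain z :: nat where z: "z < 2 ^ s" "\<And>i. bit z i \<longleftrightarrow> i < s \<and> (bit y i \<or> \<not> bit v i \<or> i = c)"
        using ex_nat_bits[of s "\<lambda>i. bit y i \<or> \<not> bit v i \<or> i = c"] by blast
      have "y < z" using bit_less[OF y] False bs by (intro bits_less[of 0 y z c]) (auto simp: z)
      moreover have "covers s v z" by (auto simp: covers_def z)
      then have "hole v z" by (rule hole_covers[OF vq])
      moreover have "xor v (xor y z) = j"
      proof (rule bit_eqI)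
        fix i
        show "bit (xor v (xor y z)) i \<longleftrightarrow> bit j i"
          using rq[of i] bit_p2[of i] bit_less[OF v, of i] bit_less[OF y, of i] 4(2) False j_low bs
          by (cases "i = c") (auto simp: bit_xor_iff z)
      qed
      moreover have "a v < a j" using vsub 4(2) vq by (intro before_j[OF v]) auto
      moreover have yj: "bit y i \<longleftrightarrow> \<not> bit q i \<or> i = b" if "i < s" "\<not> bit j i" for i
        using rq[of i] bit_p2[of i] bit_q[of i] that False b_less 4(2) by (cases "i = c") auto
      have "hole j y" using yj neqs bit_p1 by (auto simp: hole_def)
      moreover have "covers s j z" using yj bit_q by (auto simp: covers_def z)
      then have "hole j z" by (rule hole_covers[OF neqs(4,5)])
      ultimately show ?thesis using z(1) by (intro exI[of _ z] conjI) simp_all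
    qed
  next
    case 5
    have rq: "bit p\<^sub>2 i \<longleftrightarrow> i < s \<and> (bit v i \<or> \<not> bit y i)" for i using r[of i] 5(1) by simp
    have "bit v i \<longrightarrow> bit p\<^sub>1 i" for i using vr 5 bit_p2[of i] bit_p1[of i] by auto
    moreover have "bit y i \<longleftrightarrow> \<not> bit q i \<or> i = b" if "i < s" "\<not> bit v i" for i
      using rq[of i] that bit_p2[of i] bit_q[of i] j_low b_less by (cases "i = b") auto
    ultimately have "hole v y" using vq by (simp add: hole_def)
    then show ?thesis using n by simp
  qed
qed

text \<open>Only two moves survive: a column with both \<open>b\<close> and \<open>c\<close>
  receives from one with exactly one of them, which in turn receives from one with neither. Two
  columns with exactly one each lack the least index outside \<open>q\<close>; so does their
  partner, and \<open>y\<close> is no hole there.\<close>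

lemma hole_rank_q:
  assumes y: "y < 2 ^ s" "y' < 2 ^ s" and h: "hole q y" "hole q y'"
    and r: "r = xor q (xor y y')" and ord: "a q < a r" and hr: "hole r y"
  shows "rank q y' < rank q y"
proof -
  have bs: "b < s" "c < s" using b_less by simp_all
  have rlt: "r < 2 ^ s" using less(4) y by (simp add: r xor_less_power2)
  have rq: "r \<noteq> q" using ord by auto
  have br: "bit r i \<longleftrightarrow> (bit q i \<noteq> (bit y i \<noteq> bit y' i))" for i by (simp add: r bit_xor_iff)
  have rb: "bit r b \<longleftrightarrow> bit y b = bit y' b" "bit r c \<longleftrightarrow> bit y c = bit y' c"
    using br[of b] br[of c] bit_q by auto
  consider "bit y b = bit y c" "bit y' b = bit y' c" | "bit y b = bit y c" "bit y' b \<noteq> bit y' c"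
    | "bit y b \<noteq> bit y c" "bit y' b = bit y' c" | "bit y b \<noteq> bit y c" "bit y' b \<noteq> bit y' c" by blast
  then show ?thesis
  proof cases
    case 1
    then have "covers s q y" "covers s q y'" using h by (simp_all add: hole_def)
    then have "\<forall>i. bit r i \<longrightarrow> bit q i" using covers_bit_eq[OF _ _ y] br by metis
    then have "r = p\<^sub>1 \<or> r = p\<^sub>2" using inverted[OF less(4) rlt _ ord] by blast
    then have "bit r b \<noteq> bit r c" using bit_p1 bit_p2 j_low b_less by auto
    then show ?thesis using 1 rb by simp
  next
    case 2
    then have cy: "covers s q y" and "misses_lowest s q y'" using h by (simp_all add: hole_def)
    then obtain m where m: "m < s" "\<not> bit q m" "\<not> bit y' m" by (auto simp: misses_lowest_def)
    then have "bit r m" using br[of m] cy by (auto simp: covers_def)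
    then have "covers s r y" using hr hole_iff_covers m(2) by blast
    then have "bit r b \<or> bit y b" "bit r c \<or> bit y c" using bs by (simp_all add: covers_def)
    then have "bit y b" using 2 rb by auto
    then show ?thesis using 2 by (simp add: rank_def)
  next
    case 3
    then have cy: "covers s q y'" and "misses_lowest s q y" using h by (simp_all add: hole_def)
    then obtain m where m: "m < s" "\<not> bit q m" "\<not> bit y m" by (auto simp: misses_lowest_def)
    then have "bit r m" using br[of m] cy by (auto simp: covers_def)
    then have "covers s r y" using hr hole_iff_covers m(2) by blast
    then have "bit r b \<or> bit y b" "bit r c \<or> bit y c" using bs by (simp_all add: covers_def)
    then have "\<not> bit y' b" using 3 rb by auto
    then show ?thesis using 3 by (simp add: rank_def)
  next
    case 4
    then have "misses_lowest s q y" and ml: "misses_lowest s q y'" using h by (simp_all add: hole_def)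
    then obtain m where m: "m < s" "\<not> bit q m" "\<forall>i<m. bit q i" "\<not> bit y m" by (auto simp: misses_lowest_def)
    have "\<not> bit y' m" using misses_lowest_bit[OF ml m(2,3)] .
    then have rm: "\<not> bit r m" using br[of m] m by simp
    have "\<not> covers s q y" "\<not> covers s r y" using m rm by (auto simp: covers_def)
    moreover have "r \<noteq> p\<^sub>2 \<or> bit y c"
    proof (rule ccontr)
      assume "\<not> ?thesis"
      then have "\<not> bit r b" "bit r c" using bit_p2 j_low b_less by auto
      then show False using rb 4 by auto
    qed
    ultimately have False using hr rq m rm by (auto simp: hole_def split: if_splits)
    then show ?thesis ..
  qed
qed

text \<open>The receiving column has \<open>c\<close> and the other lacks it. For two columns with
  \<open>c\<close> the partner would be a subset of \<open>q\<close> that precedes \<open>q\<close>,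
  hence also \<open>p\<^sub>2\<close>.\<close>

lemma hole_rank_p2:
  assumes y: "y < 2 ^ s" "y' < 2 ^ s" and h: "hole p\<^sub>2 y" "hole p\<^sub>2 y'"
    and r: "r = xor p\<^sub>2 (xor y y')" and ord: "a p\<^sub>2 < a r" and hr: "hole r y"
  shows "rank p\<^sub>2 y' < rank p\<^sub>2 y"
proof -
  have rlt: "r < 2 ^ s" using less(3) y by (simp add: r xor_less_power2)
  have rp: "r \<noteq> p\<^sub>2" "r \<noteq> q" using ord q_before by auto
  have br: "bit r i \<longleftrightarrow> (bit p\<^sub>2 i \<noteq> (bit y i \<noteq> bit y' i))" for i by (simp add: r bit_xor_iff)
  have rc: "bit r c \<longleftrightarrow> bit y c = bit y' c" using br[of c] bit_p2 by auto
  have "bit y c"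
  proof (rule ccontr)
    assume yc: "\<not> bit y c"
    then have "misses_lowest s q y" using h neqs by (simp add: hole_def)
    then obtain m where m: "m < s" "\<not> bit q m" "\<forall>i<m. bit q i" "\<not> bit y m" by (auto simp: misses_lowest_def)
    have pm: "\<not> bit p\<^sub>2 m" using m(2) p2_subset_q by blast
    show False
    proof (cases "bit y' c")
      case True
      then have "covers s q y'" using h neqs by (simp add: hole_def)
      then have "bit r m" using br[of m] m pm by (auto simp: covers_def)
      then have "covers s r y" using hr hole_iff_covers m(2) by blast
      then show False using rc True yc b_less by (auto simp: covers_def)
    next
      case False
      then have "misses_lowest s q y'" using h neqs by (simp add: hole_def)
      then have "\<not> bit y' m" using misses_lowest_bit m(2,3) by blast
      then have "\<not> covers s r y" using br[of m] m pm by (auto simp: covers_def)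
      moreover have "bit r c" "\<not> bit p\<^sub>1 c" using rc yc False bit_p1 j_low b_less by auto
      ultimately show False using hr rp by (auto simp: hole_def)
    qed
  qed
  moreover have "\<not> bit y' c"
  proof
    assume y'c: "bit y' c"
    then have "covers s q y" "covers s q y'" using h neqs \<open>bit y c\<close> by (simp_all add: hole_def)
    then have "bit r i \<longrightarrow> bit q i" for i
      using covers_bit_eq[OF _ _ y, of q i] br[of i] p2_subset_q by auto
    moreover have "r \<noteq> p\<^sub>1" using rc y'c \<open>bit y c\<close> bit_p1[of c] j_low b_less by auto
    ultimately have "a r < a q" using rp by (intro before[OF rlt less(4)]) auto
    then show False using ord q_before by simp
  qed
  ultimately show ?thesis using neqs by (simp add: rank_def)
qed

lemma hole_rank:
  assumes v: "v < 2 ^ s" and y: "y < 2 ^ s" "y' < 2 ^ s" and h: "hole v y" "hole v y'"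
    and r: "r = xor v (xor y y')" and ord: "a v < a r" and hr: "hole r y"
  shows "rank v y' < rank v y"
proof (cases "v = q \<or> v = p\<^sub>2")
  case True
  then show ?thesis using hole_rank_q hole_rank_p2 y h r ord hr by blast
next
  case False
  then have vq: "v \<noteq> q" "v \<noteq> p\<^sub>2" by auto
  have rlt: "r < 2 ^ s" using v y by (simp add: r xor_less_power2)
  have br: "bit r i \<longleftrightarrow> (bit v i \<noteq> (bit y i \<noteq> bit y' i))" for i by (simp add: r bit_xor_iff)
  have differ: "\<not> (\<forall>i. \<not> bit v i \<longrightarrow> bit y i = bit y' i)"
  proof
    assume "\<forall>i. \<not> bit v i \<longrightarrow> bit y i = bit y' i"
    then have "\<forall>i. bit r i \<longrightarrow> bit v i" using br by blast
    then show False using inverted[OF v rlt _ ord] vq by blast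
  qed
  have neq: "covers s v y \<noteq> covers s v y'"
  proof
    assume eq: "covers s v y = covers s v y'"
    have "bit y i = bit y' i" if "\<not> bit v i" for i
    proof (cases "covers s v y")
      case True
      then show ?thesis using covers_bit_eq[OF _ _ y] eq that by simp
    next
      case False
      then have "i < s \<Longrightarrow> bit y i = bit y' i" using h eq vq that by (simp add: hole_def)
      then show ?thesis using bit_less[OF y(1), of i] bit_less[OF y(2), of i] by blast
    qed
    then show False using differ by blast
  qed
  then have vp: "\<forall>i. bit v i \<longrightarrow> bit p\<^sub>1 i" using h vq by (auto simp: hole_def)
  have Y: "bit z i \<longleftrightarrow> \<not> bit q i \<or> i = b" if "hole v z" "\<not> covers s v z" "i < s" "\<not> bit v i" for z i
    using that vq by (auto simp: hole_def)
  have vc: "\<not> bit v c" using vp bit_p1[of c] j_low b_less by auto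
  \<comment> \<open>Outside \<open>v\<close> the partner agrees with \<open>p\<^sub>2\<close>: one
    column is full there, the other is the complement of \<open>p\<^sub>2\<close>.\<close>
  have out: "bit r i \<longleftrightarrow> bit q i \<and> i \<noteq> b" if "\<not> bit v i" for i
  proof (cases "i < s")
    case True
    show ?thesis
    proof (cases "covers s v y")
      case c: True
      then have "bit y i" "bit y' i \<longleftrightarrow> \<not> bit q i \<or> i = b"
        using Y[OF h(2) _ True that] neq that True by (auto simp: covers_def)
      then show ?thesis using br[of i] that by simp
    next
      case c: False
      then have "bit y' i" "bit y i \<longleftrightarrow> \<not> bit q i \<or> i = b"
        using Y[OF h(1) _ True that] neq that True by (auto simp: covers_def)
      then show ?thesis using br[of i] that by simp
    qed
  next
    case False
    then show ?thesis using bit_less[OF rlt, of i] bit_less[OF less(4), of i] by blast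
  qed
  have "bit r c" using out vc bit_q b_less by auto
  then have cr: "covers s r y" if "r \<noteq> q" "r \<noteq> p\<^sub>2"
    using hr that bit_p1[of c] j_low b_less by (auto simp: hole_def)
  let ?A = "\<lambda>y. {i. i \<noteq> b \<and> bit v i \<and> bit y i}"
  have fin: "finite (?A y)" by (rule finite_subset[of _ "{..<s}"]) (use bit_less[OF v] in auto)
  have no_lowest: "\<not> misses_lowest s q y"
  proof
    assume "misses_lowest s q y"
    then obtain m where m: "m < s" "\<not> bit q m" "\<not> bit y m" by (auto simp: misses_lowest_def)
    then have "\<not> bit v m" using vp bit_p1[of m] bit_q[of m] by auto
    then show False using Y[OF h(1), of m] m by (auto simp: covers_def)
  qed
  have rank: "rank v z = 4 * card (?A z) + (if \<not> bit v b then of_bool (covers s v z)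
    else if covers s v z then if bit z b then 3 else 1 else if bit z b then 0 else 2)" for z
    using vq by (simp add: rank_def)
  show ?thesis
  proof (cases "r = q \<or> r = p\<^sub>2")
    case True
    have "bit y i = bit y' i" if "i \<noteq> b" "bit v i" for i
      using True br[of i] vp that bit_p1[of i] bit_q[of i] bit_p2[of i] by auto
    then have A: "?A y' = ?A y" by blast
    show ?thesis
    proof (cases "r = q")
      case rq: True
      have vb: "bit v b" using out[of b] rq bit_q[of b] by blast
      then have yb: "bit y b = bit y' b" using br[of b] rq bit_q[of b] by blast
      have yc: "bit y b = bit y c" using hr rq no_lowest by (auto simp: hole_def split: if_splits)
      show ?thesis
      proof (cases "covers s v y")
        case c: True
        then have "bit y c" using vc b_less by (auto simp: covers_def)
        then show ?thesis using c neq vb yb yc A by (simp add: rank)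
      next
        case c: False
        then have "\<not> bit y c" using Y[OF h(1) c _ vc] b_less bit_q[of c] by auto
        then show ?thesis using c neq vb yb yc A by (simp add: rank)
      qed
    next
      case False
      then have rp: "r = p\<^sub>2" using True by blast
      have "bit y c" using hr rp neqs no_lowest by (auto simp: hole_def split: if_splits)
      then have c: "covers s v y" using Y[OF h(1) _ _ vc] b_less bit_q[of c] by auto
      have "bit v b \<Longrightarrow> bit y b \<noteq> bit y' b" using br[of b] rp bit_p2[of b] j_low b_less by auto
      then show ?thesis using c neq A by (auto simp: rank)
    qed
  next
    case False
    then have cov: "covers s r y" using cr by blast
    have le: "bit y i" if "bit v i" "bit y' i" for i
      using that br[of i] cov bit_less[OF v, of i] by (auto simp: covers_def)
    \<comment> \<open>A partner other than \<open>q\<close> and \<open>p\<^sub>2\<close> must differ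
      from them inside \<open>v\<close> and away from \<open>b\<close>, so the trace shrinks
      strictly.\<close>
    have "\<exists>i. i \<noteq> b \<and> bit v i \<and> \<not> bit r i"
    proof (rule ccontr)
      assume *: "\<not> ?thesis"
      have "r = (if bit r b then q else p\<^sub>2)"
      proof (rule bit_eqI)
        fix i
        show "bit r i \<longleftrightarrow> bit (if bit r b then q else p\<^sub>2) i"
          using * out[of i] vp bit_p1[of i] bit_q[of i] bit_p2[of i] j_low b_less
          by (cases "i = b"; cases "bit v i") auto
      qed
      then show False using False by (metis (full_types))
    qed
    then obtain i where i: "i \<noteq> b" "bit v i" "\<not> bit r i" by blast
    then have "bit y i \<noteq> bit y' i" using br[of i] by blast
    then have "?A y' \<subset> ?A y" using le i by blast
    then have "card (?A y') < card (?A y)" using fin by (rule psubset_card_mono[rotated])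
    then show ?thesis by (auto simp: rank)
  qed
qed

end

subsection \<open>The five transpositions\<close>

lemma bits_subset_less: "x < y" if "\<forall>i. bit x i \<longrightarrow> bit y i" "x \<noteq> y" for x y :: nat
  using bits_subset_le[OF that(1)] that(2) by simp

lemma bit_block:
  fixes h l :: nat
  assumes "l < 4"
  shows "bit (4 * h + l) i \<longleftrightarrow> (if i = 0 then odd l else if i = 1 then 2 \<le> l else bit h (i - 2))"
proof -
  consider "i = 0" | "i = 1" | i' where "i = Suc (Suc i')"
    by (metis One_nat_def not0_implies_Suc)
  then show ?thesis
  proof cases
    case 2
    have "odd ((4 * h + l) div 2) \<longleftrightarrow> 2 \<le> l" using assms by presburger
    then show ?thesis by (simp add: 2 bit_Suc bit_0)
  next
    case 3
    have "(4 * h + l) div 2 div 2 = h" using assms by simp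
    then show ?thesis by (simp add: 3 bit_Suc)
  qed (simp add: bit_0)
qed

lemma covers_criterion:
  fixes a :: "nat \<Rightarrow> nat"
  assumes a: "\<And>x. a (a x) = x" "\<And>x. x < 2 ^ s \<Longrightarrow> a x < 2 ^ s"
    and L: "L = permute_rows a (xor_square s)"
    and before: "\<And>v w. \<lbrakk>\<forall>i. bit v i \<longrightarrow> bit w i; v \<noteq> w\<rbrakk> \<Longrightarrow> a v < a w"
  shows "two_critical (2 ^ s) (gcs (2 ^ s) L) L \<and> strong_completion (2 ^ s) (gcs (2 ^ s) L) L \<and>
    completes_top_down (2 ^ s) (gcs (2 ^ s) L) L"
\<comment> \<open>A constant rank suffices because no two holes of a row are related: their partner
  is contained in \<open>v\<close> and cannot come after it.\<close>
proof (rule permuted_xor_square_criterion[where E = "covers s" and f = "\<lambda>_ _. 0", OF a L])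
  fix v y :: nat
  assume v: "v < 2 ^ s" and y: "y < 2 ^ s" and nc: "\<not> covers s v y"
  obtain y' where y': "y' < 2 ^ s" "y < y'" "\<And>i. bit y' i \<longleftrightarrow> i < s \<and> (bit y i \<or> \<not> bit v i)"
    and r: "\<And>i. bit (xor v (xor y y')) i \<longleftrightarrow> i < s \<and> (bit v i \<or> \<not> bit y i)"
    using covers_intercalate[OF v y nc] by blast
  have "v \<noteq> xor v (xor y y')" using nc r unfolding covers_def by metis
  then have "a v < a (xor v (xor y y'))" using r bit_less[OF v] by (intro before) auto
  moreover have "covers s (xor v (xor y y')) y" "covers s (xor v (xor y y')) y'" "covers s v y'"
    by (auto simp: covers_def r y')
  ultimately show "\<exists>y'<2 ^ s. y < y' \<and> covers s v y' \<and> a v < a (xor v (xor y y')) \<and>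
      covers s (xor v (xor y y')) y \<and> covers s (xor v (xor y y')) y'"
    using y'(1,2) by (intro exI[of _ y'] conjI)
next
  fix v y y' :: nat
  assume y: "y < 2 ^ s" "y' < 2 ^ s" and h: "covers s v y" "covers s v y'"
    and ord: "a v < a (xor v (xor y y'))"
  have "\<forall>i. bit (xor v (xor y y')) i \<longrightarrow> bit v i"
    using covers_bit_eq[OF h y] by (auto simp: bit_xor_iff)
  then have "a (xor v (xor y y')) < a v" using ord by (intro before) auto
  then show "(0::nat) < 0" using ord by simp
qed

lemma inverted_bit_criterion:
  assumes a: "\<And>x. a (a x) = x" "\<And>x. x < 2 ^ s \<Longrightarrow> a x < 2 ^ s"
    and L: "L = permute_rows a (xor_square s)" and "inverted_bit s b c p q q\<^sub>2 a"
  shows "two_critical (2 ^ s) (gcs (2 ^ s) L) L \<and> strong_completion (2 ^ s) (gcs (2 ^ s) L) L \<and>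
    completes_top_down (2 ^ s) (gcs (2 ^ s) L) L"
proof -
  interpret inverted_bit s b c p q q\<^sub>2 a by fact
  show ?thesis
    by (rule permuted_xor_square_criterion[where E = hole and f = rank, OF a L])
       (auto intro: hole_intercalate hole_rank)
qed

lemma inverted_two_bits_criterion:
  assumes a: "\<And>x. a (a x) = x" "\<And>x. x < 2 ^ s \<Longrightarrow> a x < 2 ^ s"
    and L: "L = permute_rows a (xor_square s)" and "inverted_two_bits s b c j p\<^sub>1 p\<^sub>2 q a"
  shows "two_critical (2 ^ s) (gcs (2 ^ s) L) L \<and> strong_completion (2 ^ s) (gcs (2 ^ s) L) L \<and>
    completes_top_down (2 ^ s) (gcs (2 ^ s) L) L"
proof -
  interpret inverted_two_bits s b c j p\<^sub>1 p\<^sub>2 q a by fact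
  show ?thesis
    by (rule permuted_xor_square_criterion[where E = hole and f = rank, OF a L])
       (auto intro: hole_intercalate hole_rank)
qed

text \<open>\<open>k\<close> is even, so \<open>k + 1\<close> adds the index 0, and this is the only
  inverted pair. The place of \<open>q\<^sub>2\<close> is taken by \<open>set_bit 1 k\<close>, which
  is \<open>k\<close> itself when \<open>l = 2\<close>.\<close>

lemma inverted_bit_adjacent:
  assumes "2 \<le> s" "k = 4 * h + l" "l = 0 \<or> l = 2" "k + 1 < 2 ^ s"
  shows "inverted_bit s 0 1 k (k + 1) (set_bit 1 k) (transpose k (k + 1))"
proof
  have bit_k: "bit k i \<longleftrightarrow> (if i = 0 then False else if i = 1 then 2 \<le> l else bit h (i - 2))"
    and bit_k1: "bit (k + 1) i \<longleftrightarrow> (if i = 0 then True else if i = 1 then 2 \<le> l else bit h (i - 2))" for i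
    using bit_block[of l h i] bit_block[of "l + 1" h i] assms(2,3) by (auto simp: add.assoc)
  show q: "bit (k + 1) i \<longleftrightarrow> i = 0 \<or> bit k i" for i
    unfolding bit_k bit_k1 by simp
  show p: "\<not> bit k 0" unfolding bit_k by simp
  show q2: "bit (set_bit 1 k) i \<longleftrightarrow> i = 1 \<or> bit k i" for i
    by (auto simp: bit_set_bit_iff)
  show "k < 2 ^ s" "k + 1 < 2 ^ s" using assms(4) by simp_all
  then show "set_bit 1 k < 2 ^ s"
    using bit_less[of k s] assms(1) by (auto simp: less_power2_iff bit_set_bit_iff)
  show "transpose k (k + 1) v < transpose k (k + 1) w"
    if "\<forall>i. bit v i \<longrightarrow> bit w i" "v \<noteq> w" "\<not> (v = k \<and> (w = k + 1 \<or> w = set_bit 1 k))" for v w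
    using bits_subset_less[OF that(1,2)] that(3) by (auto simp: transpose_def)
  show "w = k \<and> (v = k + 1 \<or> v = set_bit 1 k)"
    if "\<forall>i. bit w i \<longrightarrow> bit v i" "transpose k (k + 1) v < transpose k (k + 1) w" for v w
  proof -
    have "w < v" by (rule bits_subset_less[OF that(1)]) (use that(2) in auto)
    then show ?thesis using that(2) by (auto simp: transpose_def split: if_splits)
  qed
  show "transpose k (k + 1) (k + 1) < transpose k (k + 1) k" by (simp add: transpose_def)
  show "transpose k (k + 1) v < transpose k (k + 1) k"
    if "\<forall>i. bit v i \<longrightarrow> bit (k + 1) i" "bit v 0" "v \<noteq> k + 1" for v
  proof -
    have "v \<noteq> k" using that(2) p by blast
    then have "v < k" using bits_subset_less[OF that(1,3)] by simp
    then show ?thesis by (simp add: transpose_def)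
  qed
qed (use assms(1) in auto)

text \<open>The block is now ordered \<open>k + 2\<close>, \<open>k + 1\<close>, \<open>k\<close>,
  \<open>k + 3\<close>, so \<open>k\<close> comes after both its extensions by 0 and by 1.\<close>

lemma inverted_bit_distance_two:
  assumes "2 \<le> s" "k = 4 * h" "k + 2 < 2 ^ s"
  shows "inverted_bit s 0 1 k (k + 1) (k + 2) (transpose k (k + 2))"
proof
  have bit_k: "bit k i \<longleftrightarrow> (if i = 0 then False else if i = 1 then False else bit h (i - 2))"
    and bit_k1: "bit (k + 1) i \<longleftrightarrow> (if i = 0 then True else if i = 1 then False else bit h (i - 2))"
    and bit_k2: "bit (k + 2) i \<longleftrightarrow> (if i = 0 then False else if i = 1 then True else bit h (i - 2))" for i
    using bit_block[of 0 h i] bit_block[of 1 h i] bit_block[of 2 h i] assms(2) by auto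
  show "bit (k + 1) i \<longleftrightarrow> i = 0 \<or> bit k i" for i
    unfolding bit_k bit_k1 by simp
  show p: "\<not> bit k 0" unfolding bit_k by simp
  show "bit (k + 2) i \<longleftrightarrow> i = 1 \<or> bit k i" for i
    unfolding bit_k bit_k2 by simp
  have incomparable: "\<not> (\<forall>i. bit (k + 1) i \<longrightarrow> bit (k + 2) i)"
    unfolding bit_k1 bit_k2 by (auto intro: exI[of _ 0])
  show "k < 2 ^ s" "k + 1 < 2 ^ s" "k + 2 < 2 ^ s" using assms(3) by simp_all
  show "transpose k (k + 2) v < transpose k (k + 2) w"
    if "\<forall>i. bit v i \<longrightarrow> bit w i" "v \<noteq> w" "\<not> (v = k \<and> (w = k + 1 \<or> w = k + 2))" for v w
  proof -
    have "\<not> (v = k + 1 \<and> w = k + 2)" using that(1) incomparable by blast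
    then show ?thesis using bits_subset_less[OF that(1,2)] that(3) by (auto simp: transpose_def)
  qed
  show "w = k \<and> (v = k + 1 \<or> v = k + 2)"
    if "\<forall>i. bit w i \<longrightarrow> bit v i" "transpose k (k + 2) v < transpose k (k + 2) w" for v w
  proof -
    have "w < v" by (rule bits_subset_less[OF that(1)]) (use that(2) in auto)
    moreover have "\<not> (w = k + 1 \<and> v = k + 2)" using that(1) incomparable by blast
    ultimately show ?thesis using that(2) by (auto simp: transpose_def split: if_splits)
  qed
  show "transpose k (k + 2) (k + 1) < transpose k (k + 2) k" by (simp add: transpose_def)
  show "transpose k (k + 2) v < transpose k (k + 2) k"
    if "\<forall>i. bit v i \<longrightarrow> bit (k + 1) i" "bit v 0" "v \<noteq> k + 1" for v
  proof -
    have "v \<noteq> k" using that(2) p by blast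
    then have "v < k" using bits_subset_less[OF that(1,3)] by simp
    then show ?thesis by (simp add: transpose_def)
  qed
qed (use assms(1) in auto)

text \<open>The block is now ordered \<open>j\<close>, \<open>j + 3\<close>, \<open>j + 2\<close>,
  \<open>j + 1\<close>; the exchange of \<open>j + 1\<close> with \<open>j + 2\<close> is compatible
  with inclusion.\<close>

lemma inverted_two_bits_distance_two:
  assumes "2 \<le> s" "j = 4 * h" "j + 3 < 2 ^ s"
  shows "inverted_two_bits s 0 1 j (j + 1) (j + 2) (j + 3) (transpose (j + 1) (j + 3))"
proof
  have bit_j: "bit j i \<longleftrightarrow> (if i = 0 then False else if i = 1 then False else bit h (i - 2))"
    and bit_1: "bit (j + 1) i \<longleftrightarrow> (if i = 0 then True else if i = 1 then False else bit h (i - 2))"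
    and bit_2: "bit (j + 2) i \<longleftrightarrow> (if i = 0 then False else if i = 1 then True else bit h (i - 2))"
    and bit_3: "bit (j + 3) i \<longleftrightarrow> (if i = 0 then True else if i = 1 then True else bit h (i - 2))" for i
    using bit_block[of 0 h i] bit_block[of 1 h i] bit_block[of 2 h i] bit_block[of 3 h i] assms(2)
    by auto
  show "bit (j + 1) i \<longleftrightarrow> i = 0 \<or> bit j i" "bit (j + 2) i \<longleftrightarrow> i = 1 \<or> bit j i"
    "bit (j + 3) i \<longleftrightarrow> i = 0 \<or> i = 1 \<or> bit j i" "\<not> bit j 0" "\<not> bit j 1" for i
    unfolding bit_j bit_1 bit_2 bit_3 by simp_all
  have incomparable: "\<not> (\<forall>i. bit (j + 1) i \<longrightarrow> bit (j + 2) i)"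
    unfolding bit_1 bit_2 by (auto intro: exI[of _ 0])
  show "j < 2 ^ s" "j + 1 < 2 ^ s" "j + 2 < 2 ^ s" "j + 3 < 2 ^ s" using assms(3) by simp_all
  show "transpose (j + 1) (j + 3) v < transpose (j + 1) (j + 3) w"
    if "\<forall>i. bit v i \<longrightarrow> bit w i" "v \<noteq> w" "\<not> (w = j + 3 \<and> (v = j + 1 \<or> v = j + 2))" for v w
  proof -
    have "\<not> (v = j + 1 \<and> w = j + 2)" using that(1) incomparable by blast
    then show ?thesis using bits_subset_less[OF that(1,2)] that(3) by (auto simp: transpose_def)
  qed
  show "v = j + 3 \<and> (w = j + 1 \<or> w = j + 2)"
    if "\<forall>i. bit w i \<longrightarrow> bit v i" "transpose (j + 1) (j + 3) v < transpose (j + 1) (j + 3) w" for v w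
  proof -
    have "w < v" by (rule bits_subset_less[OF that(1)]) (use that(2) in auto)
    moreover have "\<not> (w = j + 1 \<and> v = j + 2)" using that(1) incomparable by blast
    ultimately show ?thesis using that(2) by (auto simp: transpose_def split: if_splits)
  qed
  show "transpose (j + 1) (j + 3) (j + 3) < transpose (j + 1) (j + 3) (j + 2)"
    "transpose (j + 1) (j + 3) (j + 2) < transpose (j + 1) (j + 3) (j + 1)"
    by (simp_all add: transpose_def)
  show "transpose (j + 1) (j + 3) v < transpose (j + 1) (j + 3) j"
    if "\<forall>i. bit v i \<longrightarrow> bit (j + 2) i" "bit v 1" "v \<noteq> j + 2" for v
  proof -
    have "v \<noteq> j" "v \<noteq> j + 1" using that(2) bit_j[of 1] bit_1[of 1] by auto
    then have "v < j" using bits_subset_less[OF that(1,3)] by simp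
    then show ?thesis by (simp add: transpose_def)
  qed
qed (use assms(1) in auto)

lemma transpose_adjacent_incomparable:
  fixes h v w :: nat
  assumes "\<forall>i. bit v i \<longrightarrow> bit w i" "v \<noteq> w"
  shows "transpose (4 * h + 1) (4 * h + 2) v < transpose (4 * h + 1) (4 * h + 2) w"
proof -
  have "\<not> bit (4 * h + 2) 0" "bit (4 * h + 1) 0" by (simp_all add: bit_0)
  then have "\<not> (v = 4 * h + 1 \<and> w = 4 * h + 2)" using assms(1) by blast
  then show ?thesis using bits_subset_less[OF assms] by (auto simp: transpose_def)
qed

theorem theorem5p1:
  fixes s n k k' :: nat and j :: int and L :: array
  assumes "s \<ge> 2" and "n = 2 ^ s"
    and "k < n" and "k' < n"
    and "\<bar>int k - int k'\<bar> < 3"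
    and "[j = 0] (mod 4)"
    and "j \<le> int k" and "k < k'" and "int k' < j + 4"
    and "L = permute_rows (transpose k k') (xor_square s)"
  shows "two_critical n (gcs n L) L \<and>
         strong_completion n (gcs n L) L \<and>
         completes_top_down n (gcs n L) L"
proof -
  define h where "h = k div 4"
  define l l' where "l = k mod 4" and "l' = k' mod 4"
  obtain t where "j = 4 * t" using assms(6) by (auto simp: cong_0_iff)
  then have "int k div 4 = t" "int k' div 4 = t"
    using assms(7-9) int_div_pos_eq[of "int k" 4 t "int k - 4 * t"]
      int_div_pos_eq[of "int k'" 4 t "int k' - 4 * t"] by simp_all
  then have "int (k' div 4) = int (k div 4)" by (simp only: zdiv_int of_nat_numeral)
  then have div: "k' div 4 = h" unfolding h_def by (rule of_nat_eq_iff[THEN iffD1])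
  have k: "k = 4 * h + l" "k' = 4 * h + l'" 
    by (metis h_def l_def mult_div_mod_eq, metis div l'_def mult_div_mod_eq)
  have low: "l < l'" "l' < l + 3" "l' < 4" using k assms(5,8) by (linarith, linarith, simp add: l'_def)
  note n = assms(2)
  have a: "transpose k k' (transpose k k' x) = x" "x < 2 ^ s \<Longrightarrow> transpose k k' x < 2 ^ s" for x
    using assms(3,4) n by (simp_all add: transpose_def)
  note L = assms(10)
  have "l = 0 \<and> l' = 1 \<or> l = 2 \<and> l' = 3 \<or> l = 0 \<and> l' = 2 \<or> l = 1 \<and> l' = 2 \<or> l = 1 \<and> l' = 3"
    using low by linarith
  then consider "l = 0 \<or> l = 2" "k' = k + 1" | "k = 4 * h" "k' = k + 2"
    | "k = 4 * h + 1" "k' = 4 * h + 2" | "k = 4 * h + 1" "k' = 4 * h + 3"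
    using k by fastforce
  then show ?thesis
  proof cases
    case 1
    have "inverted_bit s 0 1 k k' (set_bit 1 k) (transpose k k')"
      using inverted_bit_adjacent[OF assms(1) k(1) 1(1)] assms(4) n 1(2) by simp
    then show ?thesis unfolding n by (intro inverted_bit_criterion[where a = "transpose k k'", OF _ _ L] a)
  next
    case 2
    have "inverted_bit s 0 1 k (k + 1) k' (transpose k k')"
      using inverted_bit_distance_two[OF assms(1) 2(1)] assms(4) n 2(2) by simp
    then show ?thesis unfolding n by (intro inverted_bit_criterion[where a = "transpose k k'", OF _ _ L] a)
  next
    case 3
    show ?thesis
      unfolding n by (rule covers_criterion[where a = "transpose k k'", OF a(1) a(2) L])
        (use transpose_adjacent_incomparable 3 in simp_all)
  next
    case 4
    have "inverted_two_bits s 0 1 (4 * h) (4 * h + 1) (4 * h + 2) (4 * h + 3) (transpose k k')"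
      using inverted_two_bits_distance_two[OF assms(1) refl, of h] assms(4) n 4 by simp
    then show ?thesis unfolding n by (intro inverted_two_bits_criterion[where a = "transpose k k'", OF _ _ L] a)
  qed
qed

end
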